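(* Let $Q$ be a convex quadrilateral in the plane which is a midpoint diagonal quadrilateral. (i) There is a unique ellipse of minimal eccentricity inscribed in $Q$; that is, among all ellipses inscribed in $Q$ there is exactly one, denoted $E_I$, whose eccentricity is minimal. (ii) Furthermore, the smallest non-negative angle between equal conjugate diameters of $E_I$ equals the smallest non-negative angle between the diagonals of $Q$.
   Context: A convex quadrilateral $Q$ is called a midpoint diagonal quadrilateral if the intersection point of the diagonals of $Q$ coincides with the midpoint of at least one of the diagonals of $Q$ (parallelograms are included). An ellipse is inscribed in $Q$ if it lies inside $Q$ and is tangent to each side of $Q$. Circles count as ellipses (of eccentricity $0$). If $a\ge b>0$ are the lengths of the semi-major and semi-minor axes of an ellipse, its eccentricity is $\sqrt{1-b^2/a^2}$. A diameter of an ellipse is a chord through its center. Two diameters are conjugate if each bisects all chords parallel to the other; they are equal conjugate diameters if in addition they have the same length. A non-circular ellipse has exactly one pair of equal conjugate diameters; for a circle, the pairs of equal conjugate diameters are exactly the pairs of perpendicular diameters. The smallest non-negative angle between two line segments (or lines) that intersect is the angle in $[0,\pi/2]$ between the lines containing them. *)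

theory Defs
  imports "HOL-Analysis.Analysis"
begin

text \<open>
  A convex quadrilateral is given by its four vertices in cyclic order: no three are collinear, and
  the segments joining consecutive vertices are edges of the convex hull.  The hull is the closed
  region bounded by the quadrilateral; the diagonals are \<open>AC\<close> and \<open>BD\<close>.
\<close>

definition convex_quadrilateral :: "real^2 \<Rightarrow> real^2 \<Rightarrow> real^2 \<Rightarrow> real^2 \<Rightarrow> bool" where
  "convex_quadrilateral A B C D \<longleftrightarrow>
     \<not> collinear {A, B, C} \<and> \<not> collinear {B, C, D} \<and>
     \<not> collinear {C, D, A} \<and> \<not> collinear {D, A, B} \<and>
     closed_segment A B edge_of convex hull {A, B, C, D} \<and>
     closed_segment B C edge_of convex hull {A, B, C, D} \<and>
     closed_segment C D edge_of convex hull {A, B, C, D} \<and>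
     closed_segment D A edge_of convex hull {A, B, C, D}"

definition midpoint_diagonal :: "real^2 \<Rightarrow> real^2 \<Rightarrow> real^2 \<Rightarrow> real^2 \<Rightarrow> bool" where
  "midpoint_diagonal A B C D \<longleftrightarrow>
     (\<exists>P. closed_segment A C \<inter> closed_segment B D = {P} \<and>
          (P = midpoint A C \<or> P = midpoint B D))"

text \<open>An ellipse is the curve, not the region it bounds.\<close>

definition ellipse_path ::
  "real^2 \<Rightarrow> real^2 \<Rightarrow> real^2 \<Rightarrow> real \<Rightarrow> real \<Rightarrow> real \<Rightarrow> real^2" where
  "ellipse_path z u v a b t = z + (a * cos t) *\<^sub>R u + (b * sin t) *\<^sub>R v"

text \<open>
  \<open>ellipse_frame E z u v a b\<close>: \<open>E\<close> is the ellipse with center \<open>z\<close>, orthonormal axis directions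
  \<open>u\<close>, \<open>v\<close>, semi-major axis \<open>a\<close> and semi-minor axis \<open>b\<close>.  The set \<open>E\<close> determines \<open>z\<close>, \<open>a\<close> and
  \<open>b\<close>, so the definite descriptions below denote.
\<close>

definition ellipse_frame ::
  "(real^2) set \<Rightarrow> real^2 \<Rightarrow> real^2 \<Rightarrow> real^2 \<Rightarrow> real \<Rightarrow> real \<Rightarrow> bool" where
  "ellipse_frame E z u v a b \<longleftrightarrow>
     norm u = 1 \<and> norm v = 1 \<and> u \<bullet> v = 0 \<and> 0 < b \<and> b \<le> a \<and>
     E = range (ellipse_path z u v a b)"

definition is_ellipse :: "(real^2) set \<Rightarrow> bool" where
  "is_ellipse E \<longleftrightarrow> (\<exists>z u v a b. ellipse_frame E z u v a b)"

definition ellipse_center :: "(real^2) set \<Rightarrow> real^2" where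
  "ellipse_center E = (THE z. \<exists>u v a b. ellipse_frame E z u v a b)"

definition eccentricity :: "(real^2) set \<Rightarrow> real" where
  "eccentricity E =
     (THE e. \<exists>z u v a b. ellipse_frame E z u v a b \<and> e = sqrt (1 - b\<^sup>2 / a\<^sup>2))"

definition tangent_line_at :: "(real^2) set \<Rightarrow> real^2 \<Rightarrow> (real^2) set \<Rightarrow> bool" where
  "tangent_line_at E P L \<longleftrightarrow>
     (\<exists>z u v a b t. ellipse_frame E z u v a b \<and> P = ellipse_path z u v a b t \<and>
        L = range (\<lambda>s. P + s *\<^sub>R vector_derivative (ellipse_path z u v a b) (at t)))"

definition tangent_to_side :: "(real^2) set \<Rightarrow> real^2 \<Rightarrow> real^2 \<Rightarrow> bool" where
  "tangent_to_side E A B \<longleftrightarrow>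
     (\<exists>P \<in> closed_segment A B. tangent_line_at E P (affine hull {A, B}))"

definition inscribed_ellipse ::
  "(real^2) set \<Rightarrow> real^2 \<Rightarrow> real^2 \<Rightarrow> real^2 \<Rightarrow> real^2 \<Rightarrow> bool" where
  "inscribed_ellipse E A B C D \<longleftrightarrow>
     is_ellipse E \<and> E \<subseteq> convex hull {A, B, C, D} \<and>
     tangent_to_side E A B \<and> tangent_to_side E B C \<and>
     tangent_to_side E C D \<and> tangent_to_side E D A"

definition min_ecc_inscribed ::
  "(real^2) set \<Rightarrow> real^2 \<Rightarrow> real^2 \<Rightarrow> real^2 \<Rightarrow> real^2 \<Rightarrow> bool" where
  "min_ecc_inscribed E A B C D \<longleftrightarrow>
     inscribed_ellipse E A B C D \<and>
     (\<forall>E'. inscribed_ellipse E' A B C D \<longrightarrow> eccentricity E \<le> eccentricity E')"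

text \<open>Chords and diameters are represented by their endpoints.\<close>

definition is_chord :: "(real^2) set \<Rightarrow> real^2 \<Rightarrow> real^2 \<Rightarrow> bool" where
  "is_chord E P Q \<longleftrightarrow> P \<in> E \<and> Q \<in> E \<and> P \<noteq> Q"

definition is_diameter :: "(real^2) set \<Rightarrow> real^2 \<Rightarrow> real^2 \<Rightarrow> bool" where
  "is_diameter E P Q \<longleftrightarrow> is_chord E P Q \<and> ellipse_center E \<in> closed_segment P Q"

definition bisects_parallel_chords ::
  "(real^2) set \<Rightarrow> real^2 \<Rightarrow> real^2 \<Rightarrow> real^2 \<Rightarrow> real^2 \<Rightarrow> bool" where
  "bisects_parallel_chords E P Q R S \<longleftrightarrow>
     (\<forall>X Y. is_chord E X Y \<and> (\<exists>k. Y - X = k *\<^sub>R (S - R)) \<longrightarrow> midpoint X Y \<in> closed_segment P Q)"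

definition conjugate_diameters ::
  "(real^2) set \<Rightarrow> real^2 \<Rightarrow> real^2 \<Rightarrow> real^2 \<Rightarrow> real^2 \<Rightarrow> bool" where
  "conjugate_diameters E P Q R S \<longleftrightarrow>
     is_diameter E P Q \<and> is_diameter E R S \<and>
     bisects_parallel_chords E P Q R S \<and> bisects_parallel_chords E R S P Q"

definition equal_conjugate_diameters ::
  "(real^2) set \<Rightarrow> real^2 \<Rightarrow> real^2 \<Rightarrow> real^2 \<Rightarrow> real^2 \<Rightarrow> bool" where
  "equal_conjugate_diameters E P Q R S \<longleftrightarrow>
     conjugate_diameters E P Q R S \<and> dist P Q = dist R S"

definition vector_angle :: "real^2 \<Rightarrow> real^2 \<Rightarrow> real" where
  "vector_angle x y = arccos (x \<bullet> y / (norm x * norm y))"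

text \<open>The angle in \<open>[0, pi/2]\<close> between the lines \<open>PQ\<close> and \<open>RS\<close> (for \<open>P \<noteq> Q\<close> and \<open>R \<noteq> S\<close>).\<close>

definition smallest_angle :: "real^2 \<Rightarrow> real^2 \<Rightarrow> real^2 \<Rightarrow> real^2 \<Rightarrow> real" where
  "smallest_angle P Q R S =
     min (vector_angle (Q - P) (S - R)) (pi - vector_angle (Q - P) (S - R))"

end

theory Submission
  imports Defs
begin

text \<open>
  Let \<open>c\<close> be the intersection of the diagonals, halving \<open>AC\<close>, and write \<open>p = C - c\<close>,
  \<open>q = D - B\<close>, \<open>B = c - s q\<close>, \<open>D = c + t q\<close>.  For a linear functional \<open>l\<close>, the ellipse
  \<open>z + cos \<theta> f + sin \<theta> g\<close> is tangent to the line \<open>l = h\<close> iff \<open>(h - l z)^2 = (l f)^2 + (l g)^2\<close>.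
  In coordinates along \<open>p\<close> and \<open>q\<close> the four tangency equations force the center onto \<open>BD\<close>
  and the mixed coefficient of the dual conic to vanish, so the inscribed ellipses are exactly
  \<open>c + k q + sqrt w cos \<theta> p + sqrt m sin \<theta> q\<close> with \<open>0 < w < 1\<close>, where \<open>k\<close> and \<open>m\<close> are
  functions of \<open>w\<close>: the directions of the diagonals are conjugate for all of them.  Since
  \<open>a/b + b/a = (w |p|^2 + m |q|^2) / (sqrt (w m) |p \<times> q|)\<close>, the AM-GM inequality shows that the
  eccentricity is minimal iff \<open>w |p|^2 = m |q|^2\<close>, i.e. iff the conjugate diameters along the
  diagonals are equal; as \<open>m\<close> decreases from a positive value to \<open>0\<close>, exactly one \<open>w\<close> does this.
\<close>

section \<open>Ellipses given by conjugate semi-diameters\<close>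

definition cross2 :: "real^2 \<Rightarrow> real^2 \<Rightarrow> real" where
  "cross2 x y = x$1 * y$2 - x$2 * y$1"

text \<open>\<open>f\<close> and \<open>g\<close> are conjugate semi-diameters, not necessarily
  orthogonal or ordered by length, so no principal axes are needed. Nondegeneracy is the separate
  condition \<open>cross2 f g \<noteq> 0\<close>.\<close>

definition ellipse_from :: "real^2 \<Rightarrow> real^2 \<Rightarrow> real^2 \<Rightarrow> (real^2) set" where
  "ellipse_from z f g = range (\<lambda>t. z + cos t *\<^sub>R f + sin t *\<^sub>R g)"

lemma inner_real2: "x \<bullet> y = x$1 * y$1 + x$2 * y$2" for x y :: "real^2"
  by (simp add: inner_vec_def sum_2)

lemma norm2_real2: "(norm x)\<^sup>2 = (x$1)\<^sup>2 + (x$2)\<^sup>2" for x :: "real^2"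
  unfolding power2_norm_eq_inner inner_real2 by (simp add: power2_eq_square)

lemma cross2_Lagrange: "(cross2 x y)\<^sup>2 = (norm x)\<^sup>2 * (norm y)\<^sup>2 - (x \<bullet> y)\<^sup>2"
  unfolding norm2_real2 inner_real2 cross2_def by algebra

lemma cross2_scaleR [simp]:
  "cross2 (a *\<^sub>R x) y = a * cross2 x y" "cross2 x (a *\<^sub>R y) = a * cross2 x y"
  by (simp_all add: cross2_def algebra_simps)

text \<open>When the determinant vanishes, \<open>B - A\<close> equals its orthogonal projection
  onto \<open>C - A\<close>.\<close>

lemma cross2_eq_0_imp_collinear:
  assumes "cross2 (C - A) (B - A) = 0" "A \<noteq> C"
  shows "collinear {A, B, C}"
proof -
  have "(norm (C - A))\<^sup>2 *\<^sub>R (B - A) = ((C - A) \<bullet> (B - A)) *\<^sub>R (C - A)"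
    using assms(1) unfolding vec_eq_iff forall_2 norm2_real2 inner_real2 cross2_def
    by (simp add: algebra_simps power2_eq_square) algebra
  moreover have "(norm (C - A))\<^sup>2 \<noteq> 0" using assms(2) by simp
  ultimately have "B - A = (((C - A) \<bullet> (B - A)) / (norm (C - A))\<^sup>2) *\<^sub>R (C - A)"
    by (metis (no_types, lifting) divide_inverse_commute scaleR_scaleR left_inverse scaleR_one)
  then have "collinear {0, C - A, B - A}"
    unfolding collinear_lemma by metis
  then have "collinear {A, C, B}"
    by (subst insert_commute, subst collinear_3) (simp add: insert_commute)
  then show ?thesis by (simp add: insert_commute)
qed

text \<open>Cramer's rule. The functionals turn tangency to the sides into equations between real
  coordinates.\<close>

lemma coordinate_functionals:
  assumes "cross2 p q \<noteq> 0"
  obtains \<xi> \<eta> :: "real^2 \<Rightarrow> real" where "linear \<xi>" "linear \<eta>" "\<xi> p = 1" "\<xi> q = 0" "\<eta> p = 0" "\<eta> q = 1"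
    "\<And>x. x = \<xi> x *\<^sub>R p + \<eta> x *\<^sub>R q"
proof
  show "linear (\<lambda>x. cross2 x q / cross2 p q)" "linear (\<lambda>x. cross2 p x / cross2 p q)"
    by (auto intro!: linearI simp: cross2_def field_simps add_divide_distrib diff_divide_distrib)
  show "x = (cross2 x q / cross2 p q) *\<^sub>R p + (cross2 p x / cross2 p q) *\<^sub>R q" for x
    using assms unfolding vec_eq_iff forall_2 by (simp add: field_simps) (simp add: cross2_def algebra_simps)
qed (use assms in \<open>auto simp: cross2_def\<close>)

lemma scaleR_pair_cancel:
  assumes "cross2 p q \<noteq> 0" "a *\<^sub>R p + b *\<^sub>R q = c *\<^sub>R p + d *\<^sub>R q"
  shows "a = c \<and> b = d"
proof -
  obtain \<xi> \<eta> :: "real^2 \<Rightarrow> real" where "linear \<xi>" "linear \<eta>" "\<xi> p = 1" "\<xi> q = 0" "\<eta> p = 0" "\<eta> q = 1"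
    using coordinate_functionals[OF assms(1)] by metis
  then show ?thesis
    using arg_cong[OF assms(2), of \<xi>] arg_cong[OF assms(2), of \<eta>]
    by (simp add: linear_add linear_scale)
qed

text \<open>Serves twice: dropping the second square gives the Cauchy-Schwarz bound, and where that
  square vanishes the bound is an equality, which is tangency.\<close>

lemma sq_rotation:
  fixes x y :: real
  shows "(cos t * x + sin t * y)\<^sup>2 + (cos t * y - sin t * x)\<^sup>2 = x\<^sup>2 + y\<^sup>2"
proof -
  have "(cos t * x + sin t * y)\<^sup>2 + (cos t * y - sin t * x)\<^sup>2
      = ((cos t)\<^sup>2 + (sin t)\<^sup>2) * (x\<^sup>2 + y\<^sup>2)" by algebra
  then show ?thesis by (simp add: sin_cos_squared_add2)
qed

lemma ex_polar_real:
  fixes x y :: real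
  obtains t where "x = sqrt (x\<^sup>2 + y\<^sup>2) * cos t" "y = sqrt (x\<^sup>2 + y\<^sup>2) * sin t"
proof (cases "x\<^sup>2 + y\<^sup>2 = 0")
  case True
  then show ?thesis using that[of 0] by (simp add: sum_power2_eq_zero_iff)
next
  case False
  let ?r = "sqrt (x\<^sup>2 + y\<^sup>2)"
  have r: "?r \<noteq> 0" "?r\<^sup>2 = x\<^sup>2 + y\<^sup>2" using False by auto
  have "(x / ?r)\<^sup>2 + (y / ?r)\<^sup>2 = 1"
    unfolding power_divide r(2) using False by (metis add_divide_distrib divide_self)
  from sincos_total_2pi_le[OF this] obtain t where "x / ?r = cos t" "y / ?r = sin t" by blast
  then show ?thesis using that[of t] r by (simp add: field_simps)
qed

section \<open>Reparametrizations and invariants of an ellipse\<close>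

lemma ellipse_from_rotate:
  "ellipse_from z (cos \<phi> *\<^sub>R f + sin \<phi> *\<^sub>R g) (cos \<phi> *\<^sub>R g - sin \<phi> *\<^sub>R f) = ellipse_from z f g"
proof -
  \<comment> \<open>By the addition formulas, rotating the pair \<open>f\<close>, \<open>g\<close>
    only shifts the parameter.\<close>
  have *: "z + cos t *\<^sub>R (cos \<phi> *\<^sub>R f + sin \<phi> *\<^sub>R g) + sin t *\<^sub>R (cos \<phi> *\<^sub>R g - sin \<phi> *\<^sub>R f)
     = z + cos (t + \<phi>) *\<^sub>R f + sin (t + \<phi>) *\<^sub>R g" for t
    by (simp add: cos_add sin_add algebra_simps)
  have "z + cos t *\<^sub>R f + sin t *\<^sub>R g \<in> ellipse_from z (cos \<phi> *\<^sub>R f + sin \<phi> *\<^sub>R g) (cos \<phi> *\<^sub>R g - sin \<phi> *\<^sub>R f)" for t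
    unfolding ellipse_from_def * by (rule range_eqI[of _ _ "t - \<phi>"]) simp
  then show ?thesis unfolding ellipse_from_def * by auto
qed

lemma ellipse_from_uminus2: "ellipse_from z f (- g) = ellipse_from z f g"
proof -
  have "z + cos t *\<^sub>R f + sin t *\<^sub>R (- g) = z + cos (- t) *\<^sub>R f + sin (- t) *\<^sub>R g"
   and "z + cos t *\<^sub>R f + sin t *\<^sub>R g = z + cos (- t) *\<^sub>R f + sin (- t) *\<^sub>R (- g)" for t by simp_all
  then show ?thesis unfolding ellipse_from_def by (metis (no_types, lifting) rangeI subsetI subset_antisym image_subset_iff)
qed

lemma ellipse_from_swap: "ellipse_from z g f = ellipse_from z f g"
  using ellipse_from_rotate[of z "pi/2" f g] ellipse_from_uminus2[of z g f] by simp

lemma ellipse_from_uminus1: "ellipse_from z (- f) g = ellipse_from z f g"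
  by (metis ellipse_from_swap ellipse_from_uminus2)

text \<open>The coefficient vectors \<open>(f1, g1)\<close> of \<open>p\<close> and
  \<open>(f2, g2)\<close> of \<open>q\<close> are orthogonal, so a single rotation of the parameter
  aligns both with the axes.\<close>

lemma ellipse_from_orthogonal_coefficients:
  assumes "f1 * f2 + g1 * g2 = 0" "0 < f1\<^sup>2 + g1\<^sup>2"
  shows "ellipse_from z (f1 *\<^sub>R p + f2 *\<^sub>R q) (g1 *\<^sub>R p + g2 *\<^sub>R q)
    = ellipse_from z (sqrt (f1\<^sup>2 + g1\<^sup>2) *\<^sub>R p) (sqrt (f2\<^sup>2 + g2\<^sup>2) *\<^sub>R q)"
proof -
  define w where "w = sqrt (f1\<^sup>2 + g1\<^sup>2)"
  obtain \<phi> where \<phi>: "f1 = w * cos \<phi>" "- g1 = w * sin \<phi>"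
    using ex_polar_real[of f1 "-g1"] unfolding w_def by auto
  \<comment> \<open>The signed length of \<open>(f2, g2)\<close>; the sign is harmless because a
    semi-diameter may be negated.\<close>
  define k where "k = f2 * sin \<phi> + g2 * cos \<phi>"
  have w: "w > 0" using assms(2) by (simp add: w_def)
  have "w * (f2 * cos \<phi> - g2 * sin \<phi>) = 0"
    using assms(1) \<phi> by (simp add: algebra_simps) algebra
  then have 0: "f2 * cos \<phi> = g2 * sin \<phi>" using w by simp
  have 1: "(sin \<phi>)\<^sup>2 + (cos \<phi>)\<^sup>2 = 1" by simp
  have f2: "f2 = k * sin \<phi>" unfolding k_def using 0 1 by algebra
  have g2: "g2 = k * cos \<phi>" unfolding k_def using 0 1 by algebra
  have "f2\<^sup>2 + g2\<^sup>2 = k\<^sup>2" using f2 g2 1 by algebra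
  then have k: "sqrt (f2\<^sup>2 + g2\<^sup>2) = k \<or> sqrt (f2\<^sup>2 + g2\<^sup>2) = - k" by (simp add: abs_if)
  have "ellipse_from z (f1 *\<^sub>R p + f2 *\<^sub>R q) (g1 *\<^sub>R p + g2 *\<^sub>R q) = ellipse_from z (w *\<^sub>R p) (k *\<^sub>R q)"
    using ellipse_from_rotate[of z \<phi> "w *\<^sub>R p" "k *\<^sub>R q"] \<phi> f2 g2
    by (simp add: mult.commute[of w] mult.commute[of k] add.commute flip: minus_equation_iff)
      (metis add.commute diff_conv_add_uminus minus_minus scaleR_minus_left mult.commute)
  then show ?thesis using k ellipse_from_uminus2[of z "w *\<^sub>R p" "k *\<^sub>R q"] by (auto simp: w_def)
qed

text \<open>The maximum of \<open>l\<close> on the ellipse is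
  \<open>l z + sqrt ((l f)\<^sup>2 + (l g)\<^sup>2)\<close>, which depends only on the point set.
  Comparing the maxima of \<open>l\<close> and of its negative separates the center from the
  width.\<close>

lemma ellipse_from_support:
  fixes l :: "real^2 \<Rightarrow> real"
  assumes eq: "ellipse_from z f g = ellipse_from z' f' g'" and l: "linear l"
  shows "l z = l z' \<and> (l f)\<^sup>2 + (l g)\<^sup>2 = (l f')\<^sup>2 + (l g')\<^sup>2"
proof -
  \<comment> \<open>The left side is attained at the polar angle of \<open>(k f, k g)\<close>;
    rewriting that point in the other parametrization, Cauchy-Schwarz bounds its value by the right
    side.\<close>
  have half: "k z + sqrt ((k f)\<^sup>2 + (k g)\<^sup>2) \<le> k z' + sqrt ((k f')\<^sup>2 + (k g')\<^sup>2)"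
    if eq: "ellipse_from z f g = ellipse_from z' f' g'" and k: "linear k"
    for k :: "real^2 \<Rightarrow> real" and z f g z' f' g'
  proof -
    obtain t where t: "k f = sqrt ((k f)\<^sup>2 + (k g)\<^sup>2) * cos t" "k g = sqrt ((k f)\<^sup>2 + (k g)\<^sup>2) * sin t"
      using ex_polar_real by blast
    have 1: "cos t * k f + sin t * k g = sqrt ((k f)\<^sup>2 + (k g)\<^sup>2)"
      using t sin_cos_squared_add[of t] by algebra
    obtain t' where t': "z + cos t *\<^sub>R f + sin t *\<^sub>R g = z' + cos t' *\<^sub>R f' + sin t' *\<^sub>R g'"
      using eq unfolding ellipse_from_def by (metis (no_types, lifting) rangeI imageE)
    have "(cos t' * k f' + sin t' * k g')\<^sup>2 \<le> (k f')\<^sup>2 + (k g')\<^sup>2"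
      using sq_rotation[of t' "k f'" "k g'"] by (smt (verit) zero_le_power2)
    then have "cos t' * k f' + sin t' * k g' \<le> sqrt ((k f')\<^sup>2 + (k g')\<^sup>2)"
      by (rule real_le_rsqrt)
    then show ?thesis using arg_cong[OF t', of k] k 1 by (simp add: linear_add linear_scale)
  qed
  have l': "linear (\<lambda>x. - l x)" using l by (rule linear_compose_neg)
  have "l z = l z' \<and> sqrt ((l f)\<^sup>2 + (l g)\<^sup>2) = sqrt ((l f')\<^sup>2 + (l g')\<^sup>2)"
    using half[OF eq l] half[OF eq[symmetric] l] half[OF eq l'] half[OF eq[symmetric] l']
    by (simp only: power2_minus) linarith
  then show ?thesis by simp
qed

text \<open>Testing with both coordinates and their sum recovers the center and the whole matrix of
  the dual quadratic form; the two numerical invariants are its trace and determinant.\<close>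

lemma ellipse_from_invariants:
  assumes "ellipse_from z f g = ellipse_from z' f' g'"
  shows "z = z'" "(norm f)\<^sup>2 + (norm g)\<^sup>2 = (norm f')\<^sup>2 + (norm g')\<^sup>2"
    "(cross2 f g)\<^sup>2 = (cross2 f' g')\<^sup>2"
proof -
  have "linear (\<lambda>x::real^2. x $ i)" for i by (simp add: linearI)
  note s = ellipse_from_support[OF assms this]
  have "linear (\<lambda>x::real^2. x $ 1 + x $ 2)" by (simp add: linearI algebra_simps)
  note s3 = ellipse_from_support[OF assms this]
  show "z = z'" using s by (simp add: vec_eq_iff)
  show "(norm f)\<^sup>2 + (norm g)\<^sup>2 = (norm f')\<^sup>2 + (norm g')\<^sup>2"
    using s[of 1] s[of 2] by (simp add: norm2_real2)
  have 3: "f$1 * f$2 + g$1 * g$2 = f'$1 * f'$2 + g'$1 * g'$2"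
    using s[of 1] s[of 2] s3 by (simp add: power2_sum)
  have *: "(cross2 x y)\<^sup>2 = ((x$1)\<^sup>2 + (y$1)\<^sup>2) * ((x$2)\<^sup>2 + (y$2)\<^sup>2) - (x$1 * x$2 + y$1 * y$2)\<^sup>2" for x y
    unfolding cross2_def by algebra
  show "(cross2 f g)\<^sup>2 = (cross2 f' g')\<^sup>2" unfolding * using s[of 1] s[of 2] 3 by simp
qed

section \<open>Principal axes, center and eccentricity\<close>

lemma ellipse_path_eq: "ellipse_path z u v a b t = z + cos t *\<^sub>R (a *\<^sub>R u) + sin t *\<^sub>R (b *\<^sub>R v)"
  by (simp add: ellipse_path_def mult.commute)

lemma ellipse_frame_from:
  assumes "ellipse_frame E z u v a b"
  shows "E = ellipse_from z (a *\<^sub>R u) (b *\<^sub>R v)" "(norm (a *\<^sub>R u))\<^sup>2 + (norm (b *\<^sub>R v))\<^sup>2 = a\<^sup>2 + b\<^sup>2"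
    "(cross2 (a *\<^sub>R u) (b *\<^sub>R v))\<^sup>2 = a\<^sup>2 * b\<^sup>2" "cross2 (a *\<^sub>R u) (b *\<^sub>R v) \<noteq> 0"
proof -
  have u: "norm u = 1" "norm v = 1" "u \<bullet> v = 0" "0 < b" "b \<le> a"
    using assms by (auto simp: ellipse_frame_def)
  show "E = ellipse_from z (a *\<^sub>R u) (b *\<^sub>R v)"
    using assms by (simp add: ellipse_frame_def ellipse_from_def ellipse_path_eq[abs_def])
  show "(norm (a *\<^sub>R u))\<^sup>2 + (norm (b *\<^sub>R v))\<^sup>2 = a\<^sup>2 + b\<^sup>2" using u by simp
  show c: "(cross2 (a *\<^sub>R u) (b *\<^sub>R v))\<^sup>2 = a\<^sup>2 * b\<^sup>2"
    unfolding cross2_Lagrange using u by (simp add: power_mult_distrib)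
  then show "cross2 (a *\<^sub>R u) (b *\<^sub>R v) \<noteq> 0" using u by auto
qed

lemma ellipse_center_frame:
  assumes "ellipse_frame E z u v a b"
  shows "ellipse_center E = z"
  unfolding ellipse_center_def
  by (rule the_equality) (use assms ellipse_frame_from(1) ellipse_from_invariants(1) in metis)+

text \<open>Sum and product of the squared semi-axes are invariants of the set, so the unordered
  pair is determined, and \<open>b \<le> a\<close> fixes the order.\<close>

lemma eccentricity_frame:
  assumes "ellipse_frame E z u v a b"
  shows "eccentricity E = sqrt (1 - b\<^sup>2 / a\<^sup>2)"
  unfolding eccentricity_def
proof (rule the_equality)
  show "\<exists>z u v a' b'. ellipse_frame E z u v a' b' \<and> sqrt (1 - b\<^sup>2 / a\<^sup>2) = sqrt (1 - b'\<^sup>2 / a'\<^sup>2)"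
    using assms by blast
  fix e assume "\<exists>z u v a b. ellipse_frame E z u v a b \<and> e = sqrt (1 - b\<^sup>2 / a\<^sup>2)"
  then obtain z' u' v' a' b' where fr: "ellipse_frame E z' u' v' a' b'" and e: "e = sqrt (1 - b'\<^sup>2 / a'\<^sup>2)"
    by blast
  note F = ellipse_frame_from[OF assms] and F' = ellipse_frame_from[OF fr]
  have eq: "ellipse_from z (a *\<^sub>R u) (b *\<^sub>R v) = ellipse_from z' (a' *\<^sub>R u') (b' *\<^sub>R v')"
    using F(1) F'(1) by simp
  have 1: "a\<^sup>2 + b\<^sup>2 = a'\<^sup>2 + b'\<^sup>2" and 2: "a\<^sup>2 * b\<^sup>2 = a'\<^sup>2 * b'\<^sup>2"
    using ellipse_from_invariants[OF eq] F(2,3) F'(2,3) by simp_all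
  have "0 < b" "b \<le> a" "0 < b'" "b' \<le> a'" using assms fr by (auto simp: ellipse_frame_def)
  then have le: "b\<^sup>2 \<le> a\<^sup>2" "b'\<^sup>2 \<le> a'\<^sup>2" by (auto intro: power_mono)
  have "(a\<^sup>2 - a'\<^sup>2) * (a\<^sup>2 - b'\<^sup>2) = 0" using 1 2 by algebra
  then have "a\<^sup>2 = a'\<^sup>2" using 1 le by auto
  then show "e = sqrt (1 - b\<^sup>2 / a\<^sup>2)" using 1 e by simp
qed

text \<open>The principal axes are found by rotating the parameter until the two conjugate
  semi-diameters become orthogonal.\<close>

lemma ellipse_from_frame:
  assumes "cross2 f g \<noteq> 0"
  obtains \<phi> u v a b where "ellipse_frame (ellipse_from z f g) z u v a b"
    "a *\<^sub>R u = cos \<phi> *\<^sub>R f + sin \<phi> *\<^sub>R g" "b *\<^sub>R v = cos \<phi> *\<^sub>R g - sin \<phi> *\<^sub>R f"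
proof -
  define F where "F \<phi> = cos \<phi> *\<^sub>R f + sin \<phi> *\<^sub>R g" for \<phi>
  define G where "G \<phi> = cos \<phi> *\<^sub>R g - sin \<phi> *\<^sub>R f" for \<phi>
  have cont: "continuous_on S (\<lambda>\<phi>. F \<phi> \<bullet> G \<phi>)" for S
    unfolding F_def G_def by (intro continuous_intros)
  \<comment> \<open>A quarter turn reverses the sign of the inner product, so the intermediate value
    theorem gives a zero in between.\<close>
  have e: "F (pi/2) \<bullet> G (pi/2) = - (F 0 \<bullet> G 0)" by (simp add: F_def G_def inner_commute)
  have "\<exists>\<phi>. F \<phi> \<bullet> G \<phi> = 0"
  proof (cases "F 0 \<bullet> G 0 \<le> 0")
    case True
    then show ?thesis using IVT'[of "\<lambda>\<phi>. F \<phi> \<bullet> G \<phi>" 0 0 "pi/2"] e cont by auto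
  next
    case False
    then show ?thesis using IVT2'[of "\<lambda>\<phi>. F \<phi> \<bullet> G \<phi>" "pi/2" 0 0] e cont by auto
  qed
  then obtain \<phi>0 where \<phi>0: "F \<phi>0 \<bullet> G \<phi>0 = 0" by blast
  \<comment> \<open>A further quarter turn exchanges the two axes up to sign, so the longer one can
    be put first.\<close>
  have sh: "F (\<phi>0 + pi/2) = G \<phi>0" "G (\<phi>0 + pi/2) = - F \<phi>0"
    by (simp_all add: F_def G_def cos_add sin_add)
  obtain \<phi> where \<phi>: "F \<phi> \<bullet> G \<phi> = 0" "norm (G \<phi>) \<le> norm (F \<phi>)"
  proof (cases "norm (G \<phi>0) \<le> norm (F \<phi>0)")
    case True then show ?thesis using that \<phi>0 by blast
  next
    case False then show ?thesis using that[of "\<phi>0 + pi/2"] \<phi>0 sh by (simp add: inner_commute)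
  qed
  have "cross2 (F \<phi>) (G \<phi>) = ((cos \<phi>)\<^sup>2 + (sin \<phi>)\<^sup>2) * cross2 f g"
    unfolding F_def G_def cross2_def vector_add_component vector_minus_component vector_scaleR_component real_scaleR_def
    by algebra
  then have nz: "cross2 (F \<phi>) (G \<phi>) \<noteq> 0" using assms by simp
  then have nF: "F \<phi> \<noteq> 0" "G \<phi> \<noteq> 0" by (auto simp: cross2_def)
  show ?thesis
  proof (rule that[where a = "norm (F \<phi>)" and u = "(1 / norm (F \<phi>)) *\<^sub>R F \<phi>" and b = "norm (G \<phi>)"
      and v = "(1 / norm (G \<phi>)) *\<^sub>R G \<phi>" and \<phi> = \<phi>])
    have "ellipse_from z f g = ellipse_from z (F \<phi>) (G \<phi>)"
      unfolding F_def G_def by (rule ellipse_from_rotate[symmetric])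
    then show "ellipse_frame (ellipse_from z f g) z ((1 / norm (F \<phi>)) *\<^sub>R F \<phi>) ((1 / norm (G \<phi>)) *\<^sub>R G \<phi>)
        (norm (F \<phi>)) (norm (G \<phi>))"
      unfolding ellipse_frame_def ellipse_from_def ellipse_path_eq[abs_def] using nF \<phi> by simp
  qed (use nF in \<open>simp_all add: F_def G_def\<close>)
qed

lemma is_ellipse_from: "cross2 f g \<noteq> 0 \<Longrightarrow> is_ellipse (ellipse_from z f g)"
  by (metis ellipse_from_frame is_ellipse_def)

lemma ellipse_center_from: "cross2 f g \<noteq> 0 \<Longrightarrow> ellipse_center (ellipse_from z f g) = z"
  by (metis ellipse_from_frame ellipse_center_frame)

text \<open>Eccentricity increases with \<open>a/b + b/a\<close>, that is, with
  \<open>(a\<^sup>2 + b\<^sup>2) / (a * b)\<close>, a quotient of the two invariants. It is squared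
  because only the square of \<open>cross2\<close> is invariant, and cross-multiplied.\<close>

lemma eccentricity_from_le_iff:
  assumes "cross2 f g \<noteq> 0" "cross2 f' g' \<noteq> 0"
  shows "eccentricity (ellipse_from z f g) \<le> eccentricity (ellipse_from z' f' g') \<longleftrightarrow>
    ((norm f)\<^sup>2 + (norm g)\<^sup>2)\<^sup>2 * (cross2 f' g')\<^sup>2 \<le> ((norm f')\<^sup>2 + (norm g')\<^sup>2)\<^sup>2 * (cross2 f g)\<^sup>2"
proof -
  obtain u v a b where fr: "ellipse_frame (ellipse_from z f g) z u v a b"
    using ellipse_from_frame[OF assms(1)] by metis
  obtain u' v' a' b' where fr': "ellipse_frame (ellipse_from z' f' g') z' u' v' a' b'"
    using ellipse_from_frame[OF assms(2)] by metis
  have ab: "0 < b" "b \<le> a" "0 < b'" "b' \<le> a'" "0 < a" "0 < a'"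
    using fr fr' by (auto simp: ellipse_frame_def)
  have inv: "(norm f)\<^sup>2 + (norm g)\<^sup>2 = a\<^sup>2 + b\<^sup>2" "(cross2 f g)\<^sup>2 = (a * b)\<^sup>2"
     "(norm f')\<^sup>2 + (norm g')\<^sup>2 = a'\<^sup>2 + b'\<^sup>2" "(cross2 f' g')\<^sup>2 = (a' * b')\<^sup>2"
    using ellipse_frame_from[OF fr] ellipse_from_invariants ellipse_frame_from[OF fr']
    by (metis power_mult_distrib)+
  have "eccentricity (ellipse_from z f g) \<le> eccentricity (ellipse_from z' f' g') \<longleftrightarrow> (b' / a')\<^sup>2 \<le> (b / a)\<^sup>2"
    unfolding eccentricity_frame[OF fr] eccentricity_frame[OF fr'] by (simp add: power_divide)
  also have "\<dots> \<longleftrightarrow> b' / a' \<le> b / a"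
    using ab by (simp add: power_mono_iff)
  also have "\<dots> \<longleftrightarrow> a * b' - a' * b \<le> 0"
    using ab by (simp add: field_simps)
  \<comment> \<open>The new factor is nonnegative and vanishes only if both ellipses are circles,
    when the first factor is zero as well.\<close>
  also have "\<dots> \<longleftrightarrow> (a * b' - a' * b) * (a * a' - b * b') \<le> 0"
  proof -
    have le: "b * b' \<le> a * a'" using ab by (intro mult_mono) auto
    show ?thesis
    proof (cases "b * b' = a * a'")
      case True
      have "a = b"
      proof (rule ccontr)
        assume "a \<noteq> b"
        then have "b * b' < a * b'" using ab by simp
        also have "a * b' \<le> a * a'" using ab by simp
        finally show False using True by simp
      qed
      moreover from this have "a' = b'" using True ab by simp
      ultimately show ?thesis by simp
    next
      case False
      then show ?thesis using le by (simp add: mult_le_0_iff)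
    qed
  qed
  also have "\<dots> \<longleftrightarrow> (a\<^sup>2 + b\<^sup>2) * (a' * b') \<le> (a'\<^sup>2 + b'\<^sup>2) * (a * b)"
  proof -
    have "(a * b' - a' * b) * (a * a' - b * b') = (a\<^sup>2 + b\<^sup>2) * (a' * b') - (a'\<^sup>2 + b'\<^sup>2) * (a * b)"
      by algebra
    then show ?thesis by simp
  qed
  also have "\<dots> \<longleftrightarrow> ((a\<^sup>2 + b\<^sup>2) * (a' * b'))\<^sup>2 \<le> ((a'\<^sup>2 + b'\<^sup>2) * (a * b))\<^sup>2"
    using ab by (intro power_mono_iff[symmetric]) auto
  finally show ?thesis unfolding inv by (simp add: power_mult_distrib)
qed

section \<open>Tangent lines in terms of conjugate semi-diameters\<close>

lemma vector_derivative_ellipse_path: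
  "vector_derivative (ellipse_path z u v a b) (at t) = cos t *\<^sub>R (b *\<^sub>R v) - sin t *\<^sub>R (a *\<^sub>R u)"
proof -
  have "(ellipse_path z u v a b has_vector_derivative (cos t *\<^sub>R (b *\<^sub>R v) - sin t *\<^sub>R (a *\<^sub>R u))) (at t)"
    unfolding ellipse_path_eq[abs_def] by (auto intro!: derivative_eq_intros simp: algebra_simps)
  then show ?thesis by (rule vector_derivative_at)
qed

text \<open>Tangency is defined through principal axes. These arise by rotating \<open>f\<close>,
  \<open>g\<close> by \<open>\<phi>\<close>, so the parameter \<open>\<theta>\<close> becomes
  \<open>\<theta> - \<phi>\<close> and the velocity is unchanged.\<close>

lemma tangent_line_at_from:
  assumes "cross2 f g \<noteq> 0" "P = z + cos \<theta> *\<^sub>R f + sin \<theta> *\<^sub>R g"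
    "L = range (\<lambda>s. P + s *\<^sub>R (cos \<theta> *\<^sub>R g - sin \<theta> *\<^sub>R f))"
  shows "tangent_line_at (ellipse_from z f g) P L"
proof -
  obtain \<phi> u v a b where fr: "ellipse_frame (ellipse_from z f g) z u v a b"
    and u: "a *\<^sub>R u = cos \<phi> *\<^sub>R f + sin \<phi> *\<^sub>R g" and v: "b *\<^sub>R v = cos \<phi> *\<^sub>R g - sin \<phi> *\<^sub>R f"
    using ellipse_from_frame[OF assms(1)] by metis
  have "cos (\<theta> - \<phi>) *\<^sub>R (a *\<^sub>R u) + sin (\<theta> - \<phi>) *\<^sub>R (b *\<^sub>R v)
      = cos ((\<theta> - \<phi>) + \<phi>) *\<^sub>R f + sin ((\<theta> - \<phi>) + \<phi>) *\<^sub>R g"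
    unfolding u v cos_add[of "\<theta> - \<phi>" \<phi>] sin_add[of "\<theta> - \<phi>" \<phi>] by (simp add: algebra_simps)
  then have 1: "P = ellipse_path z u v a b (\<theta> - \<phi>)"
    using assms(2) by (simp add: ellipse_path_eq algebra_simps)
  have "cos (\<theta> - \<phi>) *\<^sub>R (b *\<^sub>R v) - sin (\<theta> - \<phi>) *\<^sub>R (a *\<^sub>R u)
      = cos ((\<theta> - \<phi>) + \<phi>) *\<^sub>R g - sin ((\<theta> - \<phi>) + \<phi>) *\<^sub>R f"
    unfolding u v cos_add[of "\<theta> - \<phi>" \<phi>] sin_add[of "\<theta> - \<phi>" \<phi>] by (simp add: algebra_simps)
  then have 2: "vector_derivative (ellipse_path z u v a b) (at (\<theta> - \<phi>)) = cos \<theta> *\<^sub>R g - sin \<theta> *\<^sub>R f"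
    by (simp add: vector_derivative_ellipse_path)
  show ?thesis unfolding tangent_line_at_def assms(3) using fr 1 2 by metis
qed

text \<open>Being constant on the tangent line, \<open>l\<close> equals \<open>c\<close> at the
  point of contact and vanishes on the velocity there, which removes the second square in
  \<open>sq_rotation\<close>.\<close>

lemma tangent_to_side_dual_equation:
  fixes l :: "real^2 \<Rightarrow> real"
  assumes "tangent_to_side (ellipse_from z f g) X Y" "linear l" "l X = c" "l Y = c"
  shows "(c - l z)\<^sup>2 = (l f)\<^sup>2 + (l g)\<^sup>2"
proof -
  obtain P z' u v a b t where fr: "ellipse_frame (ellipse_from z f g) z' u v a b"
    and P: "P = ellipse_path z' u v a b t"
    and L: "affine hull {X, Y} = range (\<lambda>s. P + s *\<^sub>R vector_derivative (ellipse_path z' u v a b) (at t))"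
    using assms(1) unfolding tangent_to_side_def tangent_line_at_def by metis
  have on_line: "l x = c" if x: "x \<in> affine hull {X, Y}" for x
  proof -
    obtain i j :: real where "x = i *\<^sub>R X + j *\<^sub>R Y" "i + j = 1"
      using x unfolding affine_hull_2 by blast
    then show ?thesis using assms(2-4) by (simp add: linear_add linear_scale flip: distrib_right)
  qed
  have "P + s *\<^sub>R (cos t *\<^sub>R (b *\<^sub>R v) - sin t *\<^sub>R (a *\<^sub>R u)) \<in> affine hull {X, Y}" for s
    unfolding L vector_derivative_ellipse_path by blast
  note on_line[OF this]
  from this[of 0] this[of 1]
  have 1: "l P = c" and 2: "cos t * l (b *\<^sub>R v) - sin t * l (a *\<^sub>R u) = 0"
    using assms(2) by (simp_all add: linear_add linear_diff linear_scale)
  have "c - l z' = cos t * l (a *\<^sub>R u) + sin t * l (b *\<^sub>R v)"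
    using 1 assms(2) unfolding P ellipse_path_eq by (simp add: linear_add linear_scale)
  then have "(c - l z')\<^sup>2 = (l (a *\<^sub>R u))\<^sup>2 + (l (b *\<^sub>R v))\<^sup>2"
    using 2 sq_rotation[of t "l (a *\<^sub>R u)" "l (b *\<^sub>R v)"] by simp
  then show ?thesis
    using ellipse_from_support[OF ellipse_frame_from(1)[OF fr] assms(2)] by simp
qed

text \<open>The center is the midpoint of the points with parameters 0 and \<open>pi\<close>, both
  in the half-plane.\<close>

lemma ellipse_from_center_le:
  fixes l :: "real^2 \<Rightarrow> real"
  assumes "ellipse_from z f g \<subseteq> convex hull V" "linear l" "\<And>x. x \<in> V \<Longrightarrow> l x \<le> c"
  shows "l z \<le> c"
proof -
  have "{x. l x \<le> c} = l -` {..c}" by auto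
  then have "convex {x. l x \<le> c}" using assms(2) convex_linear_vimage[of l "{..c}"] by simp
  then have sub: "convex hull V \<subseteq> {x. l x \<le> c}"
    using assms(3) by (intro hull_minimal) auto
  have "z + cos t *\<^sub>R f + sin t *\<^sub>R g \<in> {x. l x \<le> c}" for t
    using assms(1) sub unfolding ellipse_from_def by blast
  from this[of 0] this[of pi] show ?thesis
    using assms(2) by (simp add: linear_add linear_diff)
qed

section \<open>Ellipses inscribed in a midpoint diagonal quadrilateral\<close>

lemma tangent_to_side_commute: "tangent_to_side E X Y \<longleftrightarrow> tangent_to_side E Y X"
  by (simp add: tangent_to_side_def closed_segment_commute insert_commute)

text \<open>The halved diagonal cuts the hull into two triangles, described in coordinates
  \<open>x\<close>, \<open>y\<close> along \<open>p\<close> and \<open>q\<close> by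
  \<open>t * \<bar>x\<bar> + y \<le> t\<close> for \<open>y \<ge> 0\<close> and
  \<open>s * \<bar>x\<bar> - y \<le> s\<close> for \<open>y \<le> 0\<close>. The tangency equations
  in \<open>wm\<close> turn Cauchy-Schwarz into exactly these bounds.\<close>

lemma ellipse_from_subset_hull:
  assumes st: "0 < s" "0 < t"
    and wm: "t\<^sup>2 * w + m = (t - k)\<^sup>2" "s\<^sup>2 * w + m = (s + k)\<^sup>2" "0 < w" "0 < m" "- s < k" "k < t"
  shows "ellipse_from (c + k *\<^sub>R q) (sqrt w *\<^sub>R p) (sqrt m *\<^sub>R q)
    \<subseteq> convex hull {c - p, c - s *\<^sub>R q, c + p, c + t *\<^sub>R q}"
proof
  \<comment> \<open>The weights below are the barycentric coordinates of the point in its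
    triangle.\<close>
  have half: "c + x *\<^sub>R p + y *\<^sub>R r \<in> convex hull {c - p, c + p, c + h *\<^sub>R r}"
    if "0 < h" "0 \<le> y" "h * \<bar>x\<bar> + y \<le> h" for x y h :: real and r
  proof -
    have "y / h + \<bar>x\<bar> \<le> 1" using that by (simp add: field_simps)
    then have "0 \<le> (1 - y/h - x) / 2" "0 \<le> (1 - y/h + x) / 2" "0 \<le> y/h" using that by auto
    moreover have "c + x *\<^sub>R p + y *\<^sub>R r = ((1 - y/h - x) / 2) *\<^sub>R (c - p) + ((1 - y/h + x) / 2) *\<^sub>R (c + p) + (y/h) *\<^sub>R (c + h *\<^sub>R r)"
      using that(1) unfolding vec_eq_iff forall_2 by (simp add: field_simps)
    moreover have "(1 - y/h - x) / 2 + (1 - y/h + x) / 2 + y/h = 1" by (simp add: field_simps)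
    ultimately show ?thesis unfolding convex_hull_3 by blast
  qed
  fix v assume "v \<in> ellipse_from (c + k *\<^sub>R q) (sqrt w *\<^sub>R p) (sqrt m *\<^sub>R q)"
  then obtain \<theta> where v: "v = c + k *\<^sub>R q + cos \<theta> *\<^sub>R (sqrt w *\<^sub>R p) + sin \<theta> *\<^sub>R (sqrt m *\<^sub>R q)"
    by (auto simp: ellipse_from_def)
  define x where "x = cos \<theta> * sqrt w"
  define y where "y = k + sin \<theta> * sqrt m"
  \<comment> \<open>The sign \<open>e\<close> selects the triangle, and the absolute value treats
    its two outer sides at once.\<close>
  have bound: "h * \<bar>x\<bar> + e * (sin \<theta> * sqrt m) \<le> d"
    if "h\<^sup>2 * w + m = d\<^sup>2" "0 < h" "0 < d" "e\<^sup>2 = 1" for h d e :: real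
  proof -
    have ab: "h * \<bar>x\<bar> = \<bar>cos \<theta>\<bar> * (h * sqrt w)" using that wm by (simp add: x_def abs_mult)
    have eqn: "\<bar>cos \<theta>\<bar> * A + e * (sin \<theta> * B) = \<bar>cos \<theta>\<bar> * A + (e * sin \<theta>) * B" for A B by simp
    have "(\<bar>cos \<theta>\<bar> * A + (e * sin \<theta>) * B)\<^sup>2 + (\<bar>cos \<theta>\<bar> * B - (e * sin \<theta>) * A)\<^sup>2 = A\<^sup>2 + B\<^sup>2" for A B
    proof -
      have "(\<bar>cos \<theta>\<bar> * A + (e * sin \<theta>) * B)\<^sup>2 + (\<bar>cos \<theta>\<bar> * B - (e * sin \<theta>) * A)\<^sup>2
        = (\<bar>cos \<theta>\<bar>\<^sup>2 + e\<^sup>2 * (sin \<theta>)\<^sup>2) * (A\<^sup>2 + B\<^sup>2)" by algebra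
      then show ?thesis using that(4) by simp
    qed
    from this[of "h * sqrt w" "sqrt m"]
    have "(\<bar>cos \<theta>\<bar> * (h * sqrt w) + (e * sin \<theta>) * sqrt m)\<^sup>2 \<le> (h * sqrt w)\<^sup>2 + (sqrt m)\<^sup>2"
      by (smt (verit) zero_le_power2)
    also have "\<dots> = d\<^sup>2" using that(1) wm by (simp add: power_mult_distrib)
    finally have "\<bar>cos \<theta>\<bar> * (h * sqrt w) + (e * sin \<theta>) * sqrt m \<le> d"
      using that(3) power2_le_imp_le by fastforce
    then show ?thesis unfolding ab by (simp add: mult.assoc)
  qed
  have up: "t * \<bar>x\<bar> + y \<le> t" using bound[of t "t - k" 1] wm st by (simp add: y_def)
  have lo: "s * \<bar>x\<bar> - y \<le> s" using bound[of s "s + k" "-1"] wm st by (simp add: y_def)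
  show "v \<in> convex hull {c - p, c - s *\<^sub>R q, c + p, c + t *\<^sub>R q}"
  proof (cases "0 \<le> y")
    case True
    have "v = c + x *\<^sub>R p + y *\<^sub>R q" by (simp add: v x_def y_def algebra_simps)
    also have "\<dots> \<in> convex hull {c - p, c + p, c + t *\<^sub>R q}" using half st True up by blast
    also have "\<dots> \<subseteq> convex hull {c - p, c - s *\<^sub>R q, c + p, c + t *\<^sub>R q}" by (rule hull_mono) auto
    finally show ?thesis .
  next
    case False
    have "v = c + x *\<^sub>R p + (- y) *\<^sub>R (- q)" by (simp add: v x_def y_def algebra_simps)
    also have "\<dots> \<in> convex hull {c - p, c + p, c + s *\<^sub>R (- q)}"
      using half[of s "-y" x "-q"] st False lo by simp
    also have "\<dots> \<subseteq> convex hull {c - p, c - s *\<^sub>R q, c + p, c + t *\<^sub>R q}" by (rule hull_mono) auto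
    finally show ?thesis .
  qed
qed

text \<open>One side is enough: the others come from negating \<open>p\<close> or \<open>q\<close>,
  the latter with \<open>s\<close> for \<open>t\<close> and \<open>- k\<close> for \<open>k\<close>.
  The bound on \<open>t * w\<close> keeps the point of contact on the segment.\<close>

lemma ellipse_from_tangent_to_side:
  assumes cr: "cross2 p q \<noteq> 0" and t: "0 < t"
    and wm: "t\<^sup>2 * w + m = (t - k)\<^sup>2" "0 < w" "0 < m" "k < t" "t * w \<le> t - k"
  shows "tangent_to_side (ellipse_from (c + k *\<^sub>R q) (sqrt w *\<^sub>R p) (sqrt m *\<^sub>R q)) (c + p) (c + t *\<^sub>R q)"
proof -
  define d where "d = t - k"
  have d: "d > 0" using wm by (simp add: d_def)
  have sq: "sqrt w * sqrt w = w" "sqrt m * sqrt m = m" using wm by auto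
  have "(t * sqrt w / d)\<^sup>2 + (sqrt m / d)\<^sup>2 = (t\<^sup>2 * w + m) / d\<^sup>2"
    using wm(2,3) by (simp add: power_divide power_mult_distrib add_divide_distrib)
  also have "\<dots> = 1" using wm(1) d by (simp add: d_def)
  \<comment> \<open>The equality case of Cauchy-Schwarz: \<open>(cos \<theta>, sin \<theta>)\<close>
    is parallel to \<open>(t * sqrt w, sqrt m)\<close>.\<close>
  finally obtain \<theta> where \<theta>: "cos \<theta> = t * sqrt w / d" "sin \<theta> = sqrt m / d"
    using sincos_total_2pi_le by metis
  define P where "P = (c + k *\<^sub>R q) + cos \<theta> *\<^sub>R (sqrt w *\<^sub>R p) + sin \<theta> *\<^sub>R (sqrt m *\<^sub>R q)"
  define x where "x = t * w / d"
  \<comment> \<open>The point of contact, with coordinates \<open>x\<close> and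
    \<open>k + m / d\<close>, lies on the line of the side.\<close>
  have kx: "k + m / d = t * (1 - x)"
  proof -
    have "m = d * d - t * t * w" using wm(1) by (simp add: d_def power2_eq_square)
    then have "m / d = d - t * x" using d by (simp add: x_def field_simps)
    then show ?thesis by (simp add: d_def algebra_simps)
  qed
  have "P = c + (t * (sqrt w * sqrt w) / d) *\<^sub>R p + (k + sqrt m * sqrt m / d) *\<^sub>R q"
    by (simp add: P_def \<theta> algebra_simps)
  then have P: "P = c + x *\<^sub>R p + (t * (1 - x)) *\<^sub>R q"
    unfolding sq kx x_def by simp
  have x: "0 \<le> x" "x \<le> 1" using t wm d by (simp_all add: x_def d_def)
  have "P \<in> closed_segment (c + p) (c + t *\<^sub>R q)"
    unfolding in_segment by (rule exI[of _ "1 - x"]) (use x in \<open>simp add: P algebra_simps\<close>)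
  moreover have "affine hull {c + p, c + t *\<^sub>R q}
      = range (\<lambda>s. P + s *\<^sub>R (cos \<theta> *\<^sub>R (sqrt m *\<^sub>R q) - sin \<theta> *\<^sub>R (sqrt w *\<^sub>R p)))"
  proof -
    \<comment> \<open>The velocity is \<open>l\<close> times the direction of the side; as
      \<open>l \<noteq> 0\<close>, the two lines coincide.\<close>
    define l where "l = sqrt w * sqrt m / d"
    have l: "l \<noteq> 0" using wm d by (simp add: l_def)
    have dir: "cos \<theta> *\<^sub>R (sqrt m *\<^sub>R q) - sin \<theta> *\<^sub>R (sqrt w *\<^sub>R p) = l *\<^sub>R (t *\<^sub>R q - p)"
      by (simp add: \<theta> l_def algebra_simps)
    have "(c + p) + u *\<^sub>R ((c + t *\<^sub>R q) - (c + p)) = P + (u - (1 - x)) *\<^sub>R (t *\<^sub>R q - p)" for u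
      by (simp add: P algebra_simps)
    then have 1: "(c + p) + u *\<^sub>R ((c + t *\<^sub>R q) - (c + p)) = P + ((u - (1 - x)) / l) *\<^sub>R (l *\<^sub>R (t *\<^sub>R q - p))" for u
      using l by simp
    have 2: "P + u *\<^sub>R (l *\<^sub>R (t *\<^sub>R q - p)) = (c + p) + (u * l + (1 - x)) *\<^sub>R ((c + t *\<^sub>R q) - (c + p))" for u
      by (simp add: P algebra_simps)
    show ?thesis unfolding dir affine_hull_2_alt 
      by (intro subset_antisym image_subsetI) (rule range_eqI, rule 1, rule range_eqI, rule 2)
  qed
  moreover have "cross2 (sqrt w *\<^sub>R p) (sqrt m *\<^sub>R q) \<noteq> 0" using cr wm by simp
  ultimately show ?thesis
    unfolding tangent_to_side_def using tangent_line_at_from P_def by blast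
qed

text \<open>The solutions \<open>k\<close> and \<open>m\<close> of the two tangency equations in \<open>inscribed_eqs\<close>, for given \<open>w\<close>.\<close>

definition inscribed_offset :: "real \<Rightarrow> real \<Rightarrow> real \<Rightarrow> real" where
  "inscribed_offset s t w = (t - s) * (1 - w) / 2"

definition inscribed_sq :: "real \<Rightarrow> real \<Rightarrow> real \<Rightarrow> real" where
  "inscribed_sq s t w = (1 - w) * ((t + s)\<^sup>2 - (t - s)\<^sup>2 * w) / 4"

definition inscribed_family :: "real^2 \<Rightarrow> real^2 \<Rightarrow> real^2 \<Rightarrow> real \<Rightarrow> real \<Rightarrow> real \<Rightarrow> (real^2) set" where
  "inscribed_family c p q s t w = ellipse_from (c + inscribed_offset s t w *\<^sub>R q)
     (sqrt w *\<^sub>R p) (sqrt (inscribed_sq s t w) *\<^sub>R q)"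

text \<open>The second factor is at least its value \<open>4 * s * t\<close> at
  \<open>w = 1\<close>.\<close>

lemma inscribed_sq_pos:
  assumes "0 < s" "0 < t" "0 < w" "w < 1"
  shows "0 < inscribed_sq s t w"
proof -
  have "(t - s)\<^sup>2 * w \<le> (t - s)\<^sup>2 * 1" using assms by (intro mult_left_mono) auto
  also have "\<dots> < (t + s)\<^sup>2" using assms by (simp add: power2_eq_square algebra_simps)
  finally show ?thesis using assms by (simp add: inscribed_sq_def)
qed

lemma inscribed_eqs:
  "t\<^sup>2 * w + inscribed_sq s t w = (t - inscribed_offset s t w)\<^sup>2"
  "s\<^sup>2 * w + inscribed_sq s t w = (s + inscribed_offset s t w)\<^sup>2"
  unfolding inscribed_sq_def inscribed_offset_def by (simp_all add: field_simps) algebra+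

lemma inscribed_family_inscribed:
  assumes cr: "cross2 p q \<noteq> 0" and st: "0 < s" "0 < t" and w: "0 < w" "w < 1"
  shows "inscribed_ellipse (inscribed_family c p q s t w) (c - p) (c - s *\<^sub>R q) (c + p) (c + t *\<^sub>R q)"
proof -
  define k where "k = inscribed_offset s t w"
  define m where "m = inscribed_sq s t w"
  have m: "0 < m" using inscribed_sq_pos assms by (simp add: m_def)
  note eqs = inscribed_eqs[where s=s and t=t and w=w, folded k_def m_def]
  have "0 < t * (1 - w)" "0 < s * (1 - w)" "0 < t * w" "0 < s * w" using st w by auto
  \<comment> \<open>Both \<open>t - k - t * w\<close> and \<open>s + k - s * w\<close> equal
    \<open>(s + t) * (1 - w) / 2\<close>.\<close>
  then have tw: "t * w \<le> t - k" "s * w \<le> s + k" "k < t" "- s < k"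
    unfolding k_def inscribed_offset_def by (simp_all add: field_simps)
  have cr': "cross2 (- p) q \<noteq> 0" "cross2 p (- q) \<noteq> 0" "cross2 (- p) (- q) \<noteq> 0"
    using cr by (simp_all add: cross2_def)
  have E: "inscribed_family c p q s t w = ellipse_from (c + k *\<^sub>R q) (sqrt w *\<^sub>R p) (sqrt m *\<^sub>R q)"
    by (simp add: inscribed_family_def k_def m_def)
  have eqs': "s\<^sup>2 * w + m = (s - (- k))\<^sup>2" "- k < s" "s * w \<le> s - (- k)" using eqs tw by simp_all
  note T1 = ellipse_from_tangent_to_side[OF cr st(2) eqs(1) w(1) m tw(3,1), of c]
  note T2 = ellipse_from_tangent_to_side[OF cr'(1) st(2) eqs(1) w(1) m tw(3,1), of c]
  note T3 = ellipse_from_tangent_to_side[OF cr'(2) st(1) eqs'(1) w(1) m eqs'(2,3), of c]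
  note T4 = ellipse_from_tangent_to_side[OF cr'(3) st(1) eqs'(1) w(1) m eqs'(2,3), of c]
  show ?thesis
    unfolding inscribed_ellipse_def E
    using ellipse_from_subset_hull[OF st eqs w(1) m tw(4,3)] T1 T2 T3 T4 cr w m
    by (simp add: is_ellipse_from ellipse_from_uminus1 ellipse_from_uminus2 tangent_to_side_commute)
qed

text \<open>Four tangency equations constrain the center \<open>(x, y)\<close> and the dual
  coefficients \<open>w\<close>, \<open>n\<close>, \<open>m\<close>. Comparing the two sides at
  \<open>B\<close> and the two at \<open>D\<close> gives \<open>x = n = 0\<close>; the rest
  expresses \<open>y\<close> and \<open>m\<close> through \<open>w\<close>.\<close>

lemma inscribed_imp_family:
  assumes cr: "cross2 p q \<noteq> 0" and st: "0 < s" "0 < t"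
    and ins: "inscribed_ellipse E (c - p) (c - s *\<^sub>R q) (c + p) (c + t *\<^sub>R q)"
  obtains w where "0 < w" "w < 1" "E = inscribed_family c p q s t w"
proof -
  obtain z u v a b where "ellipse_frame E z u v a b"
    using ins unfolding inscribed_ellipse_def is_ellipse_def by blast
  then obtain f g where E: "E = ellipse_from z f g" and fg: "cross2 f g \<noteq> 0"
    using ellipse_frame_from(1,4) by metis
  obtain \<xi> \<eta> :: "real^2 \<Rightarrow> real" where lin: "linear \<xi>" "linear \<eta>"
    and val: "\<xi> p = 1" "\<xi> q = 0" "\<eta> p = 0" "\<eta> q = 1" and co: "\<And>x. x = \<xi> x *\<^sub>R p + \<eta> x *\<^sub>R q"
    using coordinate_functionals[OF cr] by metis
  note ls = linear_add[OF lin(1)] linear_add[OF lin(2)] linear_diff[OF lin(1)] linear_diff[OF lin(2)]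
    linear_scale[OF lin(1)] linear_scale[OF lin(2)]
  have lin': "linear (\<lambda>x. i * \<xi> x + j * \<eta> x)" for i j
    by (intro linearI) (simp_all add: ls algebra_simps)
  define x where "x = \<xi> (z - c)"
  define y where "y = \<eta> (z - c)"
  have z: "z = c + x *\<^sub>R p + y *\<^sub>R q" using co[of "z - c"] by (simp add: x_def y_def algebra_simps)
  \<comment> \<open>\<open>w\<close>, \<open>m\<close> and the mixed coefficient \<open>n\<close>
    are the entries of the dual conic in the coordinates \<open>\<xi>\<close>,
    \<open>\<eta>\<close>.\<close>
  define w where "w = (\<xi> f)\<^sup>2 + (\<xi> g)\<^sup>2"
  define m where "m = (\<eta> f)\<^sup>2 + (\<eta> g)\<^sup>2"
  define n where "n = \<xi> f * \<eta> f + \<xi> g * \<eta> g"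
  have dual: "(h - i * x - j * y)\<^sup>2 = i\<^sup>2 * w + 2 * i * j * n + j\<^sup>2 * m"
    if "tangent_to_side E (c + X) (c + Y)" "i * \<xi> X + j * \<eta> X = h" "i * \<xi> Y + j * \<eta> Y = h" for X Y i j h
  proof -
    have "(h + (i * \<xi> c + j * \<eta> c) - (i * \<xi> z + j * \<eta> z))\<^sup>2 = (i * \<xi> f + j * \<eta> f)\<^sup>2 + (i * \<xi> g + j * \<eta> g)\<^sup>2"
      by (rule tangent_to_side_dual_equation[OF that(1)[unfolded E] lin'])
        (use that(2,3) in \<open>simp_all add: ls algebra_simps\<close>)
    moreover have "h + (i * \<xi> c + j * \<eta> c) - (i * \<xi> z + j * \<eta> z) = h - i * x - j * y"
      by (simp add: z ls val algebra_simps)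
    ultimately show ?thesis unfolding w_def m_def n_def by algebra
  qed
  have T: "tangent_to_side E (c + (- p)) (c + (- s *\<^sub>R q))" "tangent_to_side E (c + (- s *\<^sub>R q)) (c + p)"
     "tangent_to_side E (c + p) (c + t *\<^sub>R q)" "tangent_to_side E (c + t *\<^sub>R q) (c + (- p))"
    using ins by (simp_all add: inscribed_ellipse_def)
  note neg = linear_neg[OF lin(1)] linear_neg[OF lin(2)]
  have e1: "(s + s * x + y)\<^sup>2 = s\<^sup>2 * w + 2 * s * n + m"
    using dual[OF T(1), of "-s" "-1" s] val by (simp add: ls neg)
  have e2: "(s - s * x + y)\<^sup>2 = s\<^sup>2 * w - 2 * s * n + m"
    using dual[OF T(2), of s "-1" s] val by (simp add: ls neg)
  have e3: "(t - t * x - y)\<^sup>2 = t\<^sup>2 * w + 2 * t * n + m"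
    using dual[OF T(3), of t 1 t] val by (simp add: ls neg)
  have e4: "(t + t * x - y)\<^sup>2 = t\<^sup>2 * w - 2 * t * n + m"
    using dual[OF T(4), of "-t" 1 t] val by (simp add: ls neg)
  have "s * (x * (s + y) - n) = 0" using e1 e2 by algebra
  then have n1: "n = x * (s + y)" using st by simp
  have "t * (x * (t - y) + n) = 0" using e3 e4 by algebra
  then have n2: "n = - x * (t - y)" using st by simp
  have "x * (s + t) = 0" using n1 n2 by algebra
  then have x: "x = 0" using st by simp
  then have n: "n = 0" using n1 by simp
  have h1: "(s + y)\<^sup>2 = s\<^sup>2 * w + m" using e1 x n by simp
  have h2: "(t - y)\<^sup>2 = t\<^sup>2 * w + m" using e3 x n by simp
  \<comment> \<open>The difference of \<open>h1\<close> and \<open>h2\<close> eliminates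
    \<open>m\<close>.\<close>
  have "(s + t) * (2 * y - (t - s) * (1 - w)) = 0" using h1 h2 by algebra
  then have y: "y = inscribed_offset s t w" using st by (simp add: inscribed_offset_def)
  have m: "m = inscribed_sq s t w" using h2 inscribed_eqs(1)[of t w s] y by simp
  have "cross2 f g = cross2 (\<xi> f *\<^sub>R p + \<eta> f *\<^sub>R q) (\<xi> g *\<^sub>R p + \<eta> g *\<^sub>R q)"
    using co by simp
  also have "\<dots> = (\<xi> f * \<eta> g - \<eta> f * \<xi> g) * cross2 p q"
    unfolding cross2_def vector_add_component vector_scaleR_component real_scaleR_def by algebra
  finally have nz: "\<xi> f * \<eta> g - \<eta> f * \<xi> g \<noteq> 0" using fg by auto
  then have "\<xi> f \<noteq> 0 \<or> \<xi> g \<noteq> 0" "\<eta> f \<noteq> 0 \<or> \<eta> g \<noteq> 0" by auto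
  then have w0: "0 < w" and m0: "0 < m"
    unfolding w_def m_def by (simp_all add: sum_power2_gt_zero_iff)
  \<comment> \<open>The equations alone also admit \<open>w > 1\<close>, with both factors of
    \<open>inscribed_sq\<close> negative. A center inside the hull makes the second factor
    nonnegative, so \<open>m > 0\<close> forces \<open>w < 1\<close>.\<close>
  have hull: "E \<subseteq> convex hull {c - p, c - s *\<^sub>R q, c + p, c + t *\<^sub>R q}"
    using ins by (simp add: inscribed_ellipse_def)
  have "\<eta> z \<le> \<eta> c + t"
    by (rule ellipse_from_center_le[OF hull[unfolded E] lin(2)]) (use st val in \<open>auto simp: ls\<close>)
  moreover have "0 * \<xi> z + (- 1) * \<eta> z \<le> - \<eta> c + s"
    by (rule ellipse_from_center_le[OF hull[unfolded E] lin']) (use st val in \<open>auto simp: ls\<close>)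
  ultimately have "- s \<le> y" "y \<le> t" by (simp_all add: z ls val)
  then have "0 \<le> (t - y) * 2" "0 \<le> (s + y) * 2" by simp_all
  then have "(t - s) * w \<le> t + s" "(s - t) * w \<le> t + s"
    by (simp_all add: y inscribed_offset_def field_simps)
  then have "\<bar>t - s\<bar> * w \<le> t + s" by (simp add: abs_if)
  then have "\<bar>t - s\<bar> * (\<bar>t - s\<bar> * w) \<le> \<bar>t - s\<bar> * (t + s)" by (rule mult_left_mono) simp
  also have "\<dots> \<le> (t + s) * (t + s)" using st by (intro mult_right_mono) auto
  finally have "0 \<le> (t + s)\<^sup>2 - (t - s)\<^sup>2 * w"
    by (simp add: power2_eq_square flip: mult.assoc)
  then have w1: "w < 1" using m0 unfolding m inscribed_sq_def
    by (simp add: zero_less_mult_iff) 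
  have "E = ellipse_from z (\<xi> f *\<^sub>R p + \<eta> f *\<^sub>R q) (\<xi> g *\<^sub>R p + \<eta> g *\<^sub>R q)"
    using E co by simp
  also have "\<dots> = ellipse_from z (sqrt w *\<^sub>R p) (sqrt m *\<^sub>R q)"
    unfolding w_def m_def
    by (rule ellipse_from_orthogonal_coefficients) (use n w0 in \<open>simp_all add: n_def w_def\<close>)
  also have "\<dots> = inscribed_family c p q s t w"
    by (simp add: inscribed_family_def z x y m)
  finally show ?thesis using that w0 w1 by blast
qed

section \<open>Minimal eccentricity within the family\<close>

lemma inscribed_sq_strict_antimono:
  assumes "0 < s" "0 < t" "0 \<le> w" "w < w'" "w' \<le> 1"
  shows "inscribed_sq s t w' < inscribed_sq s t w"
proof -
  have "(t - s)\<^sup>2 * w' \<le> (t - s)\<^sup>2 * 1" "(t - s)\<^sup>2 * w \<le> (t - s)\<^sup>2 * w'"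
    using assms by (intro mult_left_mono; simp)+
  moreover have "(t - s)\<^sup>2 < (t + s)\<^sup>2" using assms by (simp add: power2_eq_square algebra_simps)
  ultimately have "0 < (t + s)\<^sup>2 - (t - s)\<^sup>2 * w'" "(t + s)\<^sup>2 - (t - s)\<^sup>2 * w' \<le> (t + s)\<^sup>2 - (t - s)\<^sup>2 * w" by linarith+
  then have "(1 - w') * ((t + s)\<^sup>2 - (t - s)\<^sup>2 * w') < (1 - w) * ((t + s)\<^sup>2 - (t - s)\<^sup>2 * w)"
    using assms by (intro mult_less_le_imp_less) auto
  then show ?thesis by (simp add: inscribed_sq_def)
qed

text \<open>From \<open>w = 0\<close> to \<open>w = 1\<close> the left side rises from 0 to
  \<open>x\<close>, while the right side goes from a positive value to 0. Here \<open>x\<close> and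
  \<open>y\<close> stand for the squared lengths of \<open>p\<close> and \<open>q\<close>.\<close>

lemma ex_equal_inscribed_sq:
  assumes "0 < s" "0 < t" "0 < (x::real)" "0 < y"
  obtains w where "0 < w" "w < 1" "w * x = inscribed_sq s t w * y"
proof -
  have "\<exists>w\<ge>0. w \<le> 1 \<and> w * x - inscribed_sq s t w * y = 0"
  proof (rule IVT')
    show "continuous_on {0..1} (\<lambda>w. w * x - inscribed_sq s t w * y)"
      unfolding inscribed_sq_def by (intro continuous_intros) auto
  qed (use assms in \<open>simp_all add: inscribed_sq_def\<close>)
  then obtain w where w: "0 \<le> w" "w \<le> 1" "w * x = inscribed_sq s t w * y" by auto
  have "w \<noteq> 0" "w \<noteq> 1" using w(3) assms by (auto simp: inscribed_sq_def)
  then have "0 < w" "w < 1" using w by auto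
  then show ?thesis using that w(3) by blast
qed

lemma equal_inscribed_sq_unique:
  assumes "0 < s" "0 < t" "0 < (x::real)" "0 < y"
    and "0 < w" "w < 1" "w * x = inscribed_sq s t w * y"
    and "0 < w'" "w' < 1" "w' * x = inscribed_sq s t w' * y"
  shows "w = w'"
proof -
  have *: False if "w < w'" "0 < w" "w' < 1" "w * x = inscribed_sq s t w * y" "w' * x = inscribed_sq s t w' * y" for w w'
  proof -
    have "w * x < w' * x" using that(1) assms(3) by (rule mult_strict_right_mono)
    moreover have "inscribed_sq s t w' < inscribed_sq s t w"
      using that assms(1,2) by (intro inscribed_sq_strict_antimono) auto
    then have "inscribed_sq s t w' * y < inscribed_sq s t w * y"
      using assms(4) by (rule mult_strict_right_mono)
    ultimately show False using that by simp
  qed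
  show ?thesis using *[of w w'] *[of w' w] assms by (metis linorder_neqE_linordered_idom)
qed

text \<open>\<open>bal\<close> is the equality case of the AM-GM inequality for \<open>w * P\<close>
  and \<open>m * Q\<close>; the second claim holds because equality selects only one
  parameter.\<close>

lemma eccentricity_inscribed_family_le:
  assumes cr: "cross2 p q \<noteq> 0" and st: "0 < s" "0 < t" and w: "0 < w" "w < 1" and w': "0 < w'" "w' < 1"
    and bal: "w * (norm p)\<^sup>2 = inscribed_sq s t w * (norm q)\<^sup>2"
  shows "eccentricity (inscribed_family c p q s t w) \<le> eccentricity (inscribed_family c p q s t w')"
    and "eccentricity (inscribed_family c p q s t w') \<le> eccentricity (inscribed_family c p q s t w) \<Longrightarrow> w' = w"
proof -
  define P Q where "P = (norm p)\<^sup>2" and "Q = (norm q)\<^sup>2"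
  define m where "m = inscribed_sq s t w"
  define m' where "m' = inscribed_sq s t w'"
  have m: "0 < m" "0 < m'" using inscribed_sq_pos st w w' by (auto simp: m_def m'_def)
  have "p \<noteq> 0" "q \<noteq> 0" using cr by (auto simp: cross2_def)
  then have PQ: "0 < P" "0 < Q" by (auto simp: P_def Q_def)
  define d where "d = (cross2 p q)\<^sup>2"
  have d: "d > 0" using cr by (simp add: d_def)
  have bal': "w * P = m * Q" using bal by (simp add: P_def Q_def m_def)
  have nz: "cross2 (sqrt w *\<^sub>R p) (sqrt m *\<^sub>R q) \<noteq> 0" "cross2 (sqrt w' *\<^sub>R p) (sqrt m' *\<^sub>R q) \<noteq> 0"
    using cr w w' m by auto
  have K: "0 < w * m * d" using w m d by simp
  \<comment> \<open>By \<open>bal'\<close> the square is \<open>4 * (w * P) * (m * Q)\<close>, so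
    both sides of the eccentricity criterion share the factor \<open>w * m * d\<close>.\<close>
  have e: "(w * P + m * Q)\<^sup>2 * (w' * m' * d) = (4 * (w' * P) * (m' * Q)) * (w * m * d)"
    using bal' by algebra
  have gap: "(w' * P + m' * Q)\<^sup>2 - 4 * (w' * P) * (m' * Q) = (w' * P - m' * Q)\<^sup>2" by algebra
  have 1: "eccentricity (inscribed_family c p q s t w) \<le> eccentricity (inscribed_family c p q s t w')
     \<longleftrightarrow> 4 * (w' * P) * (m' * Q) \<le> (w' * P + m' * Q)\<^sup>2"
    and 2: "eccentricity (inscribed_family c p q s t w') \<le> eccentricity (inscribed_family c p q s t w)
     \<longleftrightarrow> (w' * P + m' * Q)\<^sup>2 \<le> 4 * (w' * P) * (m' * Q)"
  proof -
    have n: "(norm (sqrt w *\<^sub>R p))\<^sup>2 + (norm (sqrt m *\<^sub>R q))\<^sup>2 = w * P + m * Q"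
      "(norm (sqrt w' *\<^sub>R p))\<^sup>2 + (norm (sqrt m' *\<^sub>R q))\<^sup>2 = w' * P + m' * Q"
      "(cross2 (sqrt w *\<^sub>R p) (sqrt m *\<^sub>R q))\<^sup>2 = w * m * d"
      "(cross2 (sqrt w' *\<^sub>R p) (sqrt m' *\<^sub>R q))\<^sup>2 = w' * m' * d"
      using w w' m by (simp_all add: P_def Q_def d_def power_mult_distrib)
    show "eccentricity (inscribed_family c p q s t w) \<le> eccentricity (inscribed_family c p q s t w')
     \<longleftrightarrow> 4 * (w' * P) * (m' * Q) \<le> (w' * P + m' * Q)\<^sup>2"
     unfolding inscribed_family_def m_def[symmetric] m'_def[symmetric] eccentricity_from_le_iff[OF nz] n e
     using K by (rule mult_le_cancel_right_pos)
    show "eccentricity (inscribed_family c p q s t w') \<le> eccentricity (inscribed_family c p q s t w)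
     \<longleftrightarrow> (w' * P + m' * Q)\<^sup>2 \<le> 4 * (w' * P) * (m' * Q)"
     unfolding inscribed_family_def m_def[symmetric] m'_def[symmetric] eccentricity_from_le_iff[OF nz(2,1)] n e
     using K by (rule mult_le_cancel_right_pos)
  qed
  show "eccentricity (inscribed_family c p q s t w) \<le> eccentricity (inscribed_family c p q s t w')"
    unfolding 1 using gap by (smt (verit) zero_le_power2)
  assume "eccentricity (inscribed_family c p q s t w') \<le> eccentricity (inscribed_family c p q s t w)"
  then have "(w' * P - m' * Q)\<^sup>2 \<le> 0" unfolding 2 using gap by linarith
  then have "w' * P = m' * Q" by simp
  then show "w' = w"
    using equal_inscribed_sq_unique[OF st PQ w' _ w] bal' by (simp add: m_def m'_def)
qed

section \<open>Equal conjugate diameters\<close>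

text \<open>If the center divides \<open>PQ\<close> in the ratio \<open>u : 1 - u\<close>, then
  comparing the unit coefficient vectors of both endpoints gives
  \<open>(1 - u)\<^sup>2 = u\<^sup>2\<close>, so the endpoints are antipodal.\<close>

lemma diameter_from:
  assumes fg: "cross2 f g \<noteq> 0" and "is_diameter (ellipse_from z f g) P Q"
  obtains \<alpha> where "P = z + cos \<alpha> *\<^sub>R f + sin \<alpha> *\<^sub>R g" "Q = z - cos \<alpha> *\<^sub>R f - sin \<alpha> *\<^sub>R g"
proof -
  obtain \<alpha> \<beta> where P: "P = z + cos \<alpha> *\<^sub>R f + sin \<alpha> *\<^sub>R g" and Q: "Q = z + cos \<beta> *\<^sub>R f + sin \<beta> *\<^sub>R g"
    using assms(2) unfolding is_diameter_def is_chord_def ellipse_from_def by blast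
  have "z \<in> closed_segment P Q"
    using assms ellipse_center_from[OF fg] by (simp add: is_diameter_def)
  then obtain u where u: "0 \<le> u" "u \<le> 1" "z = (1 - u) *\<^sub>R P + u *\<^sub>R Q" by (auto simp: in_segment)
  have "((1 - u) * cos \<alpha> + u * cos \<beta>) *\<^sub>R f + ((1 - u) * sin \<alpha> + u * sin \<beta>) *\<^sub>R g = 0 *\<^sub>R f + 0 *\<^sub>R g"
    using u(3) unfolding P Q by (simp add: algebra_simps)
  from scaleR_pair_cancel[OF fg this]
  have c: "(1 - u) * cos \<alpha> = - u * cos \<beta>" and s: "(1 - u) * sin \<alpha> = - u * sin \<beta>" by auto
  have "(1 - u)\<^sup>2 * ((cos \<alpha>)\<^sup>2 + (sin \<alpha>)\<^sup>2) = u\<^sup>2 * ((cos \<beta>)\<^sup>2 + (sin \<beta>)\<^sup>2)"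
    using c s by algebra
  then have "(1 - u)\<^sup>2 = u\<^sup>2" by simp
  then have half: "u = 1/2" using u by (auto simp: power2_eq_iff)
  then have "cos \<beta> = - cos \<alpha>" "sin \<beta> = - sin \<alpha>" using c s unfolding half by simp_all
  then show ?thesis using that[of \<alpha>] P Q by simp
qed

text \<open>It suffices to test the bisection on one chord \<open>XY\<close> parallel to \<open>RS\<close> that misses the center.\<close>

lemma conjugate_diameters_parameters:
  assumes fg: "cross2 f g \<noteq> 0"
    and P: "P = z + cos \<alpha> *\<^sub>R f + sin \<alpha> *\<^sub>R g" and Q: "Q = z - cos \<alpha> *\<^sub>R f - sin \<alpha> *\<^sub>R g"
    and R: "R = z + cos \<beta> *\<^sub>R f + sin \<beta> *\<^sub>R g" and S: "S = z - cos \<beta> *\<^sub>R f - sin \<beta> *\<^sub>R g"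
    and bis: "bisects_parallel_chords (ellipse_from z f g) P Q R S"
  shows "cos \<alpha> * cos \<beta> + sin \<alpha> * sin \<beta> = 0"
proof -
  \<comment> \<open>The parameters lie symmetrically about \<open>\<beta> + pi/2\<close>, which
    makes the chord parallel to \<open>RS\<close>; as \<open>cos (pi/3) = 1/2\<close>, its midpoint
    is halfway along the conjugate radius.\<close>
  define X where "X = z + cos (\<beta> + pi/2 + pi/3) *\<^sub>R f + sin (\<beta> + pi/2 + pi/3) *\<^sub>R g"
  define Y where "Y = z + cos (\<beta> + pi/2 - pi/3) *\<^sub>R f + sin (\<beta> + pi/2 - pi/3) *\<^sub>R g"
  have cs: "cos (\<beta> + pi/2 + pi/3) = - sin \<beta> / 2 - cos \<beta> * (sqrt 3 / 2)"
    "sin (\<beta> + pi/2 + pi/3) = cos \<beta> / 2 - sin \<beta> * (sqrt 3 / 2)"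
    "cos (\<beta> + pi/2 - pi/3) = - sin \<beta> / 2 + cos \<beta> * (sqrt 3 / 2)"
    "sin (\<beta> + pi/2 - pi/3) = cos \<beta> / 2 + sin \<beta> * (sqrt 3 / 2)"
    unfolding cos_diff sin_diff cos_add[of _ "pi/3"] sin_add[of _ "pi/3"]
    by (simp_all add: cos_add sin_add cos_60 sin_60)
  have YX: "Y - X = (- sqrt 3 / 2) *\<^sub>R (S - R)"
    unfolding X_def Y_def cs R S by (simp add: vec_eq_iff field_simps)
  have "R \<noteq> S"
  proof
    assume "R = S"
    then have "R - S = 0" by simp
    then have "(2 * cos \<beta>) *\<^sub>R f + (2 * sin \<beta>) *\<^sub>R g = 0 *\<^sub>R f + 0 *\<^sub>R g"
      by (simp add: R S vec_eq_iff algebra_simps)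
    from scaleR_pair_cancel[OF fg this] show False using sin_cos_squared_add[of \<beta>] by simp
  qed
  then have "X \<noteq> Y" using YX by auto
  then have "is_chord (ellipse_from z f g) X Y"
    unfolding is_chord_def ellipse_from_def X_def Y_def by blast
  then have "midpoint X Y \<in> closed_segment P Q"
    using bis YX unfolding bisects_parallel_chords_def by blast
  then obtain u where u: "midpoint X Y = (1 - u) *\<^sub>R P + u *\<^sub>R Q" by (auto simp: in_segment)
  have "midpoint X Y = z + (- sin \<beta> / 2) *\<^sub>R f + (cos \<beta> / 2) *\<^sub>R g"
    unfolding midpoint_def X_def Y_def cs vec_eq_iff forall_2 by (simp add: field_simps)
  moreover have "(1 - u) *\<^sub>R P + u *\<^sub>R Q = z + ((1 - 2 * u) * cos \<alpha>) *\<^sub>R f + ((1 - 2 * u) * sin \<alpha>) *\<^sub>R g"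
    unfolding P Q vec_eq_iff forall_2 by (simp add: algebra_simps)
  ultimately have "(- sin \<beta> / 2) *\<^sub>R f + (cos \<beta> / 2) *\<^sub>R g = ((1 - 2 * u) * cos \<alpha>) *\<^sub>R f + ((1 - 2 * u) * sin \<alpha>) *\<^sub>R g"
    using u by (simp add: add.assoc)
  from scaleR_pair_cancel[OF fg this]
  have "sin \<beta> = - (2 * ((1 - 2 * u) * cos \<alpha>))" "cos \<beta> = 2 * ((1 - 2 * u) * sin \<alpha>)" by linarith+
  then show ?thesis by simp
qed

text \<open>The endpoints of a chord parallel to \<open>g\<close> have equal cosines and opposite
  sines, so its midpoint is \<open>z + cos \<alpha> *\<^sub>R f\<close>.\<close>

lemma bisects_parallel_chords_axes:
  assumes fg: "cross2 f g \<noteq> 0"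
  shows "bisects_parallel_chords (ellipse_from z f g) (z + f) (z - f) (z + g) (z - g)"
  unfolding bisects_parallel_chords_def
proof (intro allI impI, elim conjE exE)
  fix X Y k assume ch: "is_chord (ellipse_from z f g) X Y" and k: "Y - X = k *\<^sub>R (z - g - (z + g))"
  obtain \<alpha> \<beta> where X: "X = z + cos \<alpha> *\<^sub>R f + sin \<alpha> *\<^sub>R g" and Y: "Y = z + cos \<beta> *\<^sub>R f + sin \<beta> *\<^sub>R g"
    using ch unfolding is_chord_def ellipse_from_def by blast
  have "(cos \<beta> - cos \<alpha>) *\<^sub>R f + (sin \<beta> - sin \<alpha>) *\<^sub>R g = Y - X" unfolding X Y by (simp add: algebra_simps)
  also have "\<dots> = 0 *\<^sub>R f + (- 2 * k) *\<^sub>R g" unfolding k by (simp add: vec_eq_iff algebra_simps)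
  finally have c: "cos \<beta> = cos \<alpha>" using scaleR_pair_cancel[OF fg] by fastforce
  have "(sin \<beta>)\<^sup>2 = (sin \<alpha>)\<^sup>2" using c by (simp add: sin_squared_eq)
  moreover have "sin \<beta> \<noteq> sin \<alpha>" using ch c X Y by (auto simp: is_chord_def)
  ultimately have s: "sin \<beta> = - sin \<alpha>" by (simp add: power2_eq_iff)
  have "midpoint X Y = (1 - (1 - cos \<alpha>) / 2) *\<^sub>R (z + f) + ((1 - cos \<alpha>) / 2) *\<^sub>R (z - f)"
    unfolding midpoint_def X Y c s vec_eq_iff forall_2 by (simp add: field_simps)
  moreover have "0 \<le> (1 - cos \<alpha>) / 2" "(1 - cos \<alpha>) / 2 \<le> 1" using cos_ge_minus_one[of \<alpha>] by auto
  ultimately show "midpoint X Y \<in> closed_segment (z + f) (z - f)" unfolding in_segment by blast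
qed

text \<open>Supplies the existence of equal conjugate diameters, so that the claim about their angle
  is not vacuous.\<close>

lemma equal_conjugate_diameters_axes:
  assumes fg: "cross2 f g \<noteq> 0" and "norm f = norm g"
  shows "equal_conjugate_diameters (ellipse_from z f g) (z + f) (z - f) (z + g) (z - g)"
proof -
  have gf: "cross2 g f \<noteq> 0" using fg by (simp add: cross2_def mult.commute)
  have nz: "f \<noteq> 0" "g \<noteq> 0" using fg by (auto simp: cross2_def)
  have d: "is_diameter (ellipse_from z f g) (z + f) (z - f)" if "cross2 f g \<noteq> 0" "f \<noteq> 0" for f g
  proof -
    have "z + f \<in> ellipse_from z f g" "z - f \<in> ellipse_from z f g"
      unfolding ellipse_from_def by (rule range_eqI[of _ _ 0], simp, rule range_eqI[of _ _ pi], simp)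
    moreover have "z + f \<noteq> z - f"
    proof
      assume "z + f = z - f"
      then have "2 *\<^sub>R f = 0" by (simp add: scaleR_2 algebra_simps eq_neg_iff_add_eq_0)
      then show False using that by simp
    qed
    moreover have "z \<in> closed_segment (z + f) (z - f)"
      unfolding in_segment by (rule exI[of _ "1/2"]) (simp add: vec_eq_iff field_simps)
    ultimately show ?thesis
      using ellipse_center_from[OF that(1)] by (simp add: is_diameter_def is_chord_def)
  qed
  show ?thesis
    unfolding equal_conjugate_diameters_def conjugate_diameters_def
    using d[OF fg nz(1)] d[OF gf nz(2)] bisects_parallel_chords_axes[OF fg, of z]
      bisects_parallel_chords_axes[OF gf, of z] assms(2)
    by (simp add: ellipse_from_swap dist_norm flip: scaleR_2)
qed

text \<open>Supplementary angles have opposite cosines and \<open>arccos\<close> is decreasing, so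
  the smaller angle belongs to the absolute value.\<close>

lemma smallest_angle_eq:
  "smallest_angle P Q R S = arccos \<bar>(Q - P) \<bullet> (S - R) / (norm (Q - P) * norm (S - R))\<bar>"
proof -
  define c where "c = (Q - P) \<bullet> (S - R) / (norm (Q - P) * norm (S - R))"
  have "\<bar>(Q - P) \<bullet> (S - R)\<bar> \<le> norm (Q - P) * norm (S - R)" by (rule Cauchy_Schwarz_ineq2)
  then have "\<bar>c\<bar> \<le> 1" unfolding c_def abs_divide by (simp add: divide_le_eq)
  then have c: "- 1 \<le> c" "c \<le> 1" by auto
  have "min (arccos c) (pi - arccos c) = arccos \<bar>c\<bar>"
  proof (cases "0 \<le> c")
    case True
    then have "arccos c \<le> arccos 0" using c by (intro arccos_le_arccos) auto
    then show ?thesis using True by (simp add: min_def)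
  next
    case False
    then have "arccos 0 \<le> arccos c" using c by (intro arccos_le_arccos) auto
    then show ?thesis using False c by (simp add: min_def arccos_minus)
  qed
  then show ?thesis by (simp add: smallest_angle_def vector_angle_def c_def)
qed

lemma smallest_angle_commute: "smallest_angle R S P Q = smallest_angle P Q R S"
  by (simp add: smallest_angle_eq inner_commute mult.commute)

lemma smallest_angle_reverse: "smallest_angle Q P R S = smallest_angle P Q R S"
proof -
  have "P - Q = - (Q - P)" by simp
  then show ?thesis unfolding smallest_angle_eq by (simp only: inner_minus_left norm_minus_cancel) simp
qed

text \<open>Conjugacy makes the parameters differ by a right angle; equal lengths then force
  \<open>sin \<alpha> * cos \<alpha> * i = 0\<close>. Either the ellipse is a circle or the
  diameters lie along \<open>f\<close> and \<open>g\<close>, and the angle is the same in both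
  cases.\<close>

lemma smallest_angle_equal_conjugate_diameters:
  assumes fg: "cross2 f g \<noteq> 0" and eq: "norm f = norm g"
    and ecd: "equal_conjugate_diameters (ellipse_from z f g) P Q R S"
  shows "smallest_angle P Q R S = arccos \<bar>f \<bullet> g / (norm f * norm g)\<bar>"
proof -
  have dia: "is_diameter (ellipse_from z f g) P Q" "is_diameter (ellipse_from z f g) R S"
    and bis: "bisects_parallel_chords (ellipse_from z f g) P Q R S" and dist: "dist P Q = dist R S"
    using ecd by (auto simp: equal_conjugate_diameters_def conjugate_diameters_def)
  obtain \<alpha> where P: "P = z + cos \<alpha> *\<^sub>R f + sin \<alpha> *\<^sub>R g" and Q: "Q = z - cos \<alpha> *\<^sub>R f - sin \<alpha> *\<^sub>R g"
    using diameter_from[OF fg dia(1)] .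
  obtain \<beta> where R: "R = z + cos \<beta> *\<^sub>R f + sin \<beta> *\<^sub>R g" and S: "S = z - cos \<beta> *\<^sub>R f - sin \<beta> *\<^sub>R g"
    using diameter_from[OF fg dia(2)] .
  define r i where "r = f \<bullet> f" and "i = f \<bullet> g"
  have gg: "g \<bullet> g = r" using eq by (simp add: r_def flip: power2_norm_eq_inner)
  have "f \<noteq> 0" using fg by (auto simp: cross2_def)
  then have r: "r > 0" by (simp add: r_def)
  have perp: "cos \<alpha> * cos \<beta> + sin \<alpha> * sin \<beta> = 0" by (rule conjugate_diameters_parameters[OF fg P Q R S bis])
  have sc: "(sin \<alpha>)\<^sup>2 + (cos \<alpha>)\<^sup>2 = 1" "(sin \<beta>)\<^sup>2 + (cos \<beta>)\<^sup>2 = 1" by simp_all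
  \<comment> \<open>This is \<open>sin (\<beta> - \<alpha>)\<close>, a sign recording the
    orientation of the pair.\<close>
  define k where "k = sin \<beta> * cos \<alpha> - cos \<beta> * sin \<alpha>"
  have b: "cos \<beta> = - k * sin \<alpha>" "sin \<beta> = k * cos \<alpha>" and k2: "k\<^sup>2 = 1"
    unfolding k_def using perp sc by algebra+
  define x where "x = Q - P"
  define y where "y = S - R"
  have x: "x = (- 2) *\<^sub>R (cos \<alpha> *\<^sub>R f + sin \<alpha> *\<^sub>R g)" 
    unfolding x_def P Q vec_eq_iff by simp
  have y: "y = (2 * k) *\<^sub>R (sin \<alpha> *\<^sub>R f - cos \<alpha> *\<^sub>R g)"
    unfolding y_def R S vec_eq_iff b by (simp add: algebra_simps)
  have gf: "g \<bullet> f = i" by (simp add: i_def inner_commute)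
  note ii = inner_add_left inner_add_right inner_diff_left inner_diff_right inner_scaleR_left inner_scaleR_right
     gg gf r_def[symmetric] i_def[symmetric]
  have xx: "x \<bullet> x = 4 * (r + 2 * sin \<alpha> * cos \<alpha> * i)"
    unfolding x ii using sc(1) by algebra
  have yy: "y \<bullet> y = 4 * (r - 2 * sin \<alpha> * cos \<alpha> * i)"
    unfolding y ii using sc(1) k2 by algebra
  have xy: "x \<bullet> y = 4 * k * i * ((cos \<alpha>)\<^sup>2 - (sin \<alpha>)\<^sup>2)"
    unfolding x y ii by algebra
  have nn: "norm x = norm y" using dist by (simp add: dist_norm x_def y_def norm_minus_commute)
  then have "x \<bullet> x = y \<bullet> y" by (simp flip: power2_norm_eq_inner)
  then have sci: "sin \<alpha> * cos \<alpha> * i = 0" using xx yy by simp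
  have n1: "norm x * norm y = 4 * r"
  proof -
    have "norm x * norm y = x \<bullet> x" using nn by (simp add: power2_eq_square flip: power2_norm_eq_inner)
    then show ?thesis using xx sci by (simp add: mult.assoc)
  qed
  have n2: "norm f * norm g = r" using eq by (simp add: r_def power2_eq_square flip: power2_norm_eq_inner)
  have "\<bar>x \<bullet> y\<bar> = 4 * \<bar>i\<bar>"
  proof (cases "i = 0")
    case False
    have "((cos \<alpha>)\<^sup>2 - (sin \<alpha>)\<^sup>2)\<^sup>2 = ((sin \<alpha>)\<^sup>2 + (cos \<alpha>)\<^sup>2)\<^sup>2 - 4 * (sin \<alpha> * cos \<alpha>)\<^sup>2" by algebra
    also have "\<dots> = 1" using sci False by simp
    finally have "\<bar>(cos \<alpha>)\<^sup>2 - (sin \<alpha>)\<^sup>2\<bar> = 1" by (simp add: abs_square_eq_1)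
    moreover have "\<bar>k\<bar> = 1" using k2 by (simp add: abs_square_eq_1)
    ultimately show ?thesis by (simp add: xy abs_mult)
  qed (simp add: xy)
  then show ?thesis
    unfolding smallest_angle_eq x_def[symmetric] y_def[symmetric] n1 n2 using r
    by (simp add: abs_divide i_def[symmetric])
qed

section \<open>The ellipse of minimal eccentricity\<close>

lemma min_ecc_midpoint:
  assumes cr: "cross2 p q \<noteq> 0" and st: "0 < s" "0 < t"
    and V: "A = c - p" "B = c - s *\<^sub>R q" "C = c + p" "D = c + t *\<^sub>R q"
  shows "(\<exists>!E. min_ecc_inscribed E A B C D) \<and>
    (\<forall>E. min_ecc_inscribed E A B C D \<longrightarrow>
       (\<exists>P Q R S. equal_conjugate_diameters E P Q R S) \<and>
       (\<forall>P Q R S. equal_conjugate_diameters E P Q R S \<longrightarrow>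
          smallest_angle P Q R S = smallest_angle A C B D))"
proof -
  have "p \<noteq> 0" "q \<noteq> 0" using cr by (auto simp: cross2_def)
  then obtain w where w: "0 < w" "w < 1" and bal: "w * (norm p)\<^sup>2 = inscribed_sq s t w * (norm q)\<^sup>2"
    using ex_equal_inscribed_sq[OF st, of "(norm p)\<^sup>2" "(norm q)\<^sup>2"] by auto
  define F where "F = inscribed_family c p q s t"
  \<comment> \<open>The balanced parameter \<open>w\<close> gives the only minimizer, which settles
    existence and uniqueness together.\<close>
  have min_iff: "min_ecc_inscribed E A B C D \<longleftrightarrow> E = F w" for E
  proof
    assume E: "min_ecc_inscribed E A B C D"
    then obtain w' where w': "0 < w'" "w' < 1" "E = F w'"
      using inscribed_imp_family[OF cr st] unfolding min_ecc_inscribed_def V F_def by metis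
    have "eccentricity E \<le> eccentricity (F w)"
      using E inscribed_family_inscribed[OF cr st w] unfolding min_ecc_inscribed_def V F_def by blast
    then show "E = F w"
      using eccentricity_inscribed_family_le(2)[OF cr st w w'(1,2) bal] w'(3) unfolding F_def by blast
  next
    assume "E = F w"
    then show "min_ecc_inscribed E A B C D"
      using inscribed_family_inscribed[OF cr st w] inscribed_imp_family[OF cr st]
        eccentricity_inscribed_family_le(1)[OF cr st w _ _ bal]
      unfolding min_ecc_inscribed_def V F_def by metis
  qed
  define m where "m = inscribed_sq s t w"
  define f where "f = sqrt w *\<^sub>R p"
  define g where "g = sqrt m *\<^sub>R q"
  define z where "z = c + inscribed_offset s t w *\<^sub>R q"
  have m: "0 < m" using inscribed_sq_pos[OF st w] by (simp add: m_def)
  have Fw: "F w = ellipse_from z f g" by (simp add: F_def inscribed_family_def f_def g_def z_def m_def)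
  have fg: "cross2 f g \<noteq> 0" using cr w m by (simp add: f_def g_def)
  have "(norm f)\<^sup>2 = (norm g)\<^sup>2" using bal w m by (simp add: f_def g_def power_mult_distrib flip: m_def)
  then have eq: "norm f = norm g" by simp
  \<comment> \<open>The diagonals are positive multiples of the equal semi-diameters
    \<open>f\<close> and \<open>g\<close>, so they enclose the same angle.\<close>
  have CA: "C - A = (2 / sqrt w) *\<^sub>R f" using w by (simp add: V f_def scaleR_2)
  have DB: "D - B = ((s + t) / sqrt m) *\<^sub>R g" using m by (simp add: V g_def scaleR_add_left)
  have "0 < sqrt w" "0 < sqrt m" using w m by auto
  then have "smallest_angle A C B D = arccos \<bar>f \<bullet> g / (norm f * norm g)\<bar>"
    unfolding smallest_angle_eq CA DB using st by (simp add: abs_mult)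
  then show ?thesis
    unfolding min_iff Fw
    using smallest_angle_equal_conjugate_diameters[OF fg eq] equal_conjugate_diameters_axes[OF fg eq, of z]
    by auto
qed

text \<open>With \<open>q = D - B\<close>, the midpoint of \<open>AC\<close> lies at a fraction
  \<open>u\<close> of \<open>BD\<close>, so \<open>s = u\<close> and \<open>t = 1 - u\<close>;
  noncollearity excludes the endpoints.\<close>

lemma midpoint_diagonal_coordinates:
  assumes "\<not> collinear {A, B, C}" "\<not> collinear {C, D, A}"
    and "midpoint A C \<in> closed_segment B D"
  obtains c p q s t where "cross2 p q \<noteq> 0" "0 < s" "0 < t"
    "A = c - p" "B = c - s *\<^sub>R q" "C = c + p" "D = c + t *\<^sub>R q"
proof -
  define c where "c = midpoint A C"
  define p where "p = (1/2) *\<^sub>R (C - A)"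
  define q where "q = D - B"
  obtain u where u: "0 \<le> u" "u \<le> 1" "c = (1 - u) *\<^sub>R B + u *\<^sub>R D"
    using assms(3) by (auto simp: in_segment c_def)
  have A: "A = c - p" and C: "C = c + p"
    by (simp_all add: c_def p_def midpoint_def vec_eq_iff field_simps)
  have B: "B = c - u *\<^sub>R q" and D: "D = c + (1 - u) *\<^sub>R q"
    by (simp_all add: u(3) q_def algebra_simps)
  have "A \<noteq> C" using assms(1) by (auto simp: insert_commute collinear_2)
  have "cross2 (C - A) (B - A) = cross2 (2 *\<^sub>R p) (p - u *\<^sub>R q)" "cross2 (C - A) (D - A) = cross2 (2 *\<^sub>R p) (p + (1 - u) *\<^sub>R q)"
    unfolding A B C D by (simp_all add: scaleR_2 algebra_simps)
  then have e: "cross2 (C - A) (B - A) = - 2 * u * cross2 p q" "cross2 (C - A) (D - A) = 2 * (1 - u) * cross2 p q"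
    by (simp_all add: cross2_def algebra_simps)
  have "cross2 (C - A) (B - A) \<noteq> 0" "cross2 (C - A) (D - A) \<noteq> 0"
    using cross2_eq_0_imp_collinear[of C A B] cross2_eq_0_imp_collinear[of C A D] \<open>A \<noteq> C\<close> assms(1,2)
    by (auto simp: insert_commute)
  then have "cross2 p q \<noteq> 0" "u \<noteq> 0" "u \<noteq> 1" using e by auto
  then have "0 < u" "0 < 1 - u" using u(1,2) by simp_all
  then show ?thesis using that[OF \<open>cross2 p q \<noteq> 0\<close> _ _ A B C D] by blast
qed

theorem theorem3:
  fixes A B C D :: "real^2"
  assumes "convex_quadrilateral A B C D"
    and "midpoint_diagonal A B C D"
  shows "(\<exists>!E. min_ecc_inscribed E A B C D) \<and>
    (\<forall>E. min_ecc_inscribed E A B C D \<longrightarrow>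
       (\<exists>P Q R S. equal_conjugate_diameters E P Q R S) \<and>
       (\<forall>P Q R S. equal_conjugate_diameters E P Q R S \<longrightarrow>
          smallest_angle P Q R S = smallest_angle A C B D))"
proof -
  have nc: "\<not> collinear {A, B, C}" "\<not> collinear {C, D, A}" "\<not> collinear {B, C, D}" "\<not> collinear {D, A, B}"
    using assms(1) by (auto simp: convex_quadrilateral_def)
  obtain P where "P \<in> closed_segment A C" "P \<in> closed_segment B D" "P = midpoint A C \<or> P = midpoint B D"
    using assms(2) unfolding midpoint_diagonal_def by blast
  then consider "midpoint A C \<in> closed_segment B D" | "midpoint B D \<in> closed_segment C A"
    by (metis closed_segment_commute)
  then show ?thesis
  proof cases
    case 1
    show ?thesis
      by (rule midpoint_diagonal_coordinates[OF nc(1,2) 1]) (rule min_ecc_midpoint)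
  next
    case 2
    \<comment> \<open>Shifting the labels cyclically makes \<open>BD\<close> the halved diagonal;
      neither the inscribed ellipses nor the angle between the diagonals changes.\<close>
    have "inscribed_ellipse E B C D A \<longleftrightarrow> inscribed_ellipse E A B C D" for E
      by (auto simp: inscribed_ellipse_def insert_commute)
    then have rot: "min_ecc_inscribed E B C D A \<longleftrightarrow> min_ecc_inscribed E A B C D" for E
      by (simp add: min_ecc_inscribed_def)
    have ang: "smallest_angle B D C A = smallest_angle A C B D"
      by (metis smallest_angle_commute smallest_angle_reverse)
    show ?thesis
      by (rule midpoint_diagonal_coordinates[OF nc(3,4) 2])
        (rule min_ecc_midpoint[of _ _ _ _ B _ C D A, unfolded rot ang])
  qed
qed

end
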